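(* Let $n\ge 1$ and let $A$ be an $n \times n$ matrix over $\mathbb{FT}$. Then $A$ is von Neumann regular (i.e. there is an $n\times n$ matrix $B$ over $\mathbb{FT}$ with $ABA = A$) if and only if its row space and column space have the same pure dimension equal to their generator dimension (that is, there is an integer $k$ such that the row space and the column space of $A$ each have pure dimension $k$ and generator dimension $k$).
   Context: $\mathbb{FT}$ is the finitary tropical semiring: the set $\mathbb{R}$ with $a \oplus b = \max(a,b)$ and $a \otimes b = ab = a+b$ (usual addition). $\mathbb{FT}^n$ carries the operations of componentwise maximum $\oplus$ and scaling $(\lambda x)_i = \lambda + x_i$ for $\lambda\in\mathbb{FT}$. Matrices multiply by $(AB)_{ij} = \bigoplus_k A_{ik}\otimes B_{kj}$. The column space (respectively row space) of a matrix over $\mathbb{FT}$ is the set of vectors generated by its columns (respectively rows) under $\oplus$ and scaling by $\mathbb{FT}$. The generator dimension of a subset $X\subseteq\mathbb{FT}^n$ closed under $\oplus$ and scaling is the minimal cardinality of a generating set of $X$ under scaling and $\oplus$. Such an $X$ has pure dimension $k$ if every non-empty subset of $X$ that is open in $X$ (for the topology induced from the usual topology of $\mathbb{R}^n$) has topological dimension $k$. *)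

theory Defs
  imports "HOL-Analysis.Analysis"
begin

definition trop_add :: "real ^ 'n \<Rightarrow> real ^ 'n \<Rightarrow> real ^ 'n" where
  "trop_add x y = (\<chi> i. max (x $ i) (y $ i))"

definition trop_scale :: "real \<Rightarrow> real ^ 'n \<Rightarrow> real ^ 'n" where
  "trop_scale c x = (\<chi> i. c + x $ i)"

definition trop_mult :: "real ^ 'm ^ 'k \<Rightarrow> real ^ 'n ^ 'm \<Rightarrow> real ^ 'n ^ 'k" where
  "trop_mult A B = (\<chi> i j. MAX k. A $ i $ k + B $ k $ j)"

definition von_neumann_regular :: "real ^ 'n ^ 'n \<Rightarrow> bool" where
  "von_neumann_regular A \<longleftrightarrow> (\<exists>B :: real ^ 'n ^ 'n. trop_mult (trop_mult A B) A = A)"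

text \<open>The finitary tropical semiring has no zero element, so there is no zero vector that a
  closed set would have to contain; in particular the empty set is closed and is generated by
  the empty set.\<close>

definition trop_closed :: "(real ^ 'n) set \<Rightarrow> bool" where
  "trop_closed X \<longleftrightarrow>
     (\<forall>x\<in>X. \<forall>y\<in>X. trop_add x y \<in> X) \<and> (\<forall>c. \<forall>x\<in>X. trop_scale c x \<in> X)"

definition row_space :: "real ^ 'n ^ 'm \<Rightarrow> (real ^ 'n) set" where
  "row_space A = trop_closed hull (rows A)"

definition column_space :: "real ^ 'n ^ 'm \<Rightarrow> (real ^ 'm) set" where
  "column_space A = trop_closed hull (columns A)"

text \<open>Infinite generating sets count as \<open>\<infinity>\<close>, because \<^const>\<open>card\<close> is 0 on infinite sets.\<close>

definition generator_dim :: "(real ^ 'n) set \<Rightarrow> enat" where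
  "generator_dim X =
     (INF G \<in> {G. trop_closed hull G = X}. if finite G then enat (card G) else \<infinity>)"

text \<open>Topological dimension is the library's small inductive dimension (empty space: \<open>-1\<close>),
  which on the separable metrizable spaces used here agrees with covering dimension.\<close>

definition has_top_dim :: "'a topology \<Rightarrow> int \<Rightarrow> bool" where
  "has_top_dim T d \<longleftrightarrow> T dim_le d \<and> \<not> T dim_le (d - 1)"

definition has_pure_dim :: "(real ^ 'n) set \<Rightarrow> nat \<Rightarrow> bool" where
  "has_pure_dim X k \<longleftrightarrow>
     (\<forall>U. openin (top_of_set X) U \<and> U \<noteq> {} \<longrightarrow> has_top_dim (top_of_set U) (int k))"

end

theory Submission
  imports Defs
begin

text \<open>If \<open>A B A = A\<close>, the column space is the fixed set of the idempotent \<open>E = A B\<close>. Choose a minimal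
  set \<open>K\<close> of coordinates through which every fixed point \<open>y\<close> satisfies \<open>y\<^sub>i = max\<^sub>j (E\<^sub>i\<^sub>j + y\<^sub>j)\<close>. On \<open>K\<close>
  the matrix \<open>E\<close> has zero diagonal and negative cycles, so the column space projects homeomorphically
  onto a full-dimensional polyhedron in \<open>\<real>\<^sup>K\<close> and is generated by the columns indexed by \<open>K\<close>.

  Conversely, let \<open>G\<close> and \<open>H\<close> generate the column and the row space, with \<open>k\<close> elements each. The rows in
  \<open>H\<close> give piecewise linear coordinates \<open>z\<^sub>h\<close> on the column space, in which \<open>y = max\<^sub>g (g + x\<^sub>g)\<close> reads
  \<open>z\<^sub>h(y) = max\<^sub>g (z\<^sub>h(g) + x\<^sub>g)\<close>. Where one \<open>g\<close> attains two of these maxima, \<open>y\<close> satisfies one of finitely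
  many linear equations, so by purity the other points are dense. At those, the attaining \<open>g\<close> define a
  bijection \<open>\<sigma> : H \<rightarrow> G\<close>, the unique optimum of the assignment problem with weights \<open>z\<^sub>h(g)\<close>, hence the
  same \<open>\<sigma>\<close> everywhere. Then \<open>y = max\<^sub>h (\<sigma>(h) + z\<^sub>h(y) - z\<^sub>h(\<sigma>(h)))\<close> on the whole column space by continuity;
  for the columns of \<open>A\<close> this is \<open>A = A B A\<close>.\<close>

section \<open>Small inductive dimension in Euclidean space\<close>

text \<open>Induction on \<open>n\<close>: around each point there are arbitrarily small cubes none
  of whose face hyperplanes contains a nonempty piece \<open>T\<close>. A face lowers the dimension
  of each piece it meets by one, so the cut pieces cover the frontier of the cube and the induction
  hypothesis applies to it.\<close>

lemma dim_le_affine_cover: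
  fixes S :: "'a::euclidean_space set"
  assumes "finite F" and "\<And>T. T \<in> F \<Longrightarrow> affine T \<and> aff_dim T < int n" and "S \<subseteq> \<Union>F"
  shows "top_of_set S dim_le int n - 1"
  using assms
proof (induction n arbitrary: F S)
  case 0
  then have "T = {}" if "T \<in> F" for T
    using that aff_dim_empty[of T] aff_dim_geq[of T] by force
  with 0 show ?case
    by (force simp: subtopology_trivial_iff)
next
  case (Suc n)
  have "top_of_set S dim_le int n"
  proof (rule dimension_le.intros)
    fix V a assume V: "openin (top_of_set S) V" and "a \<in> V"
    then obtain e where "e > 0" and e: "\<And>x. x \<in> S \<Longrightarrow> dist x a < e \<Longrightarrow> x \<in> V"
      unfolding openin_euclidean_subtopology_iff by blast
    have "a \<in> S"
      using V \<open>a \<in> V\<close> openin_imp_subset by blast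
    \<comment> \<open>Half-sides below \<open>d\<close> keep the cube inside the ball of radius
      \<open>e\<close>, since the norm is at most the sum of the \<open>DIM('a)\<close> absolute
      coordinates.\<close>
    define d where "d = e / DIM('a)"
    have "d > 0"
      using \<open>e > 0\<close> by (simp add: d_def)
    \<comment> \<open>If a nonempty \<open>T\<close> lies in a face hyperplane, any one of its
      points determines \<open>r\<close>. Hence only finitely many radii have to be avoided.\<close>
    define bad where "bad = (\<Union>T\<in>F. \<Union>b\<in>Basis. {b \<bullet> (SOME x. x \<in> T) - b \<bullet> a, b \<bullet> a - b \<bullet> (SOME x. x \<in> T)})"
    have "finite bad"
      using Suc.prems(1) by (auto simp: bad_def)
    moreover have "infinite {0<..<d}"
      using \<open>d > 0\<close> by (simp add: infinite_Ioo)
    ultimately obtain r where r: "0 < r" "r < d" "r \<notin> bad"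
      by (metis (full_types) finite_subset greaterThanLessThan_iff subsetI)
    have good: "\<not> T \<subseteq> {x. b \<bullet> x = c}"
      if "T \<in> F" "b \<in> Basis" "c = b \<bullet> a + r \<or> c = b \<bullet> a - r" "T \<noteq> {}" for T b c
    proof
      assume "T \<subseteq> {x. b \<bullet> x = c}"
      then have "b \<bullet> (SOME x. x \<in> T) = c"
        using \<open>T \<noteq> {}\<close> some_in_eq by blast
      with that have "r = b \<bullet> (SOME x. x \<in> T) - b \<bullet> a \<or> r = b \<bullet> a - b \<bullet> (SOME x. x \<in> T)"
        by auto
      with r(3) that show False
        by (auto simp: bad_def)
    qed
    define U where "U = S \<inter> {x. \<forall>b\<in>Basis. \<bar>b \<bullet> (x - a)\<bar> < r}"
    define C where "C = S \<inter> {x. \<forall>b\<in>Basis. \<bar>b \<bullet> (x - a)\<bar> \<le> r}"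
    have opU: "openin (top_of_set S) U"
    proof -
      have "open {x. \<bar>b \<bullet> (x - a)\<bar> < r}" for b
        by (intro open_Collect_less continuous_intros)
      moreover have "{x. \<forall>b\<in>Basis. \<bar>b \<bullet> (x - a)\<bar> < r} = (\<Inter>b\<in>Basis. {x. \<bar>b \<bullet> (x - a)\<bar> < r})"
        by auto
      ultimately have "open {x. \<forall>b\<in>Basis. \<bar>b \<bullet> (x - a)\<bar> < r}"
        by (metis (no_types, lifting) finite_Basis open_INT)
      then show ?thesis
        unfolding U_def by (rule openin_open_Int)
    qed
    have clC: "closedin (top_of_set S) C"
    proof -
      have "closed {x. \<bar>b \<bullet> (x - a)\<bar> \<le> r}" for b
        by (intro closed_Collect_le continuous_intros)
      moreover have "{x. \<forall>b\<in>Basis. \<bar>b \<bullet> (x - a)\<bar> \<le> r} = (\<Inter>b\<in>Basis. {x. \<bar>b \<bullet> (x - a)\<bar> \<le> r})"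
        by auto
      ultimately have "closed {x. \<forall>b\<in>Basis. \<bar>b \<bullet> (x - a)\<bar> \<le> r}"
        by (metis (no_types, lifting) closed_INT)
      then show ?thesis
        unfolding C_def by (rule closedin_closed_Int)
    qed
    have "U \<subseteq> V"
    proof
      fix x assume x: "x \<in> U"
      have "norm (x - a) \<le> (\<Sum>b\<in>Basis. \<bar>(x - a) \<bullet> b\<bar>)"
        by (rule norm_le_l1)
      also have "\<dots> \<le> (\<Sum>b\<in>(Basis::'a set). r)"
        using x by (intro sum_mono) (auto simp: U_def inner_commute less_imp_le)
      also have "\<dots> < e"
        using r by (simp add: d_def field_simps)
      finally show "x \<in> V"
        using e[of x] x by (simp add: U_def dist_norm)
    qed
    define Fr where "Fr = top_of_set S frontier_of U"
    have "Fr \<subseteq> C - U"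
    proof -
      have "U \<subseteq> C"
        by (auto simp: U_def C_def less_imp_le)
      with clC have "top_of_set S closure_of U \<subseteq> C"
        by (simp add: closure_of_minimal)
      with opU show ?thesis
        by (auto simp: Fr_def frontier_of_openin)
    qed
    define F' where "F' = (\<Union>T\<in>F. \<Union>b\<in>Basis. {T \<inter> {x. b \<bullet> x = b \<bullet> a + r}, T \<inter> {x. b \<bullet> x = b \<bullet> a - r}})"
    have "top_of_set Fr dim_le int n - 1"
    proof (rule Suc.IH)
      show "finite F'"
        using Suc.prems(1) by (auto simp: F'_def)
      show "affine T' \<and> aff_dim T' < int n" if T'F': "T' \<in> F'" for T'
      proof -
        obtain T b where "T \<in> F" "b \<in> Basis"
          and "T' = T \<inter> {x. b \<bullet> x = b \<bullet> a + r} \<or> T' = T \<inter> {x. b \<bullet> x = b \<bullet> a - r}"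
          using T'F' by (auto simp: F'_def)
        then obtain c where T: "T \<in> F" "b \<in> Basis" "c = b \<bullet> a + r \<or> c = b \<bullet> a - r"
          and T': "T' = T \<inter> {x. b \<bullet> x = c}"
          by blast
        have "affine T" "aff_dim T < int (Suc n)"
          using Suc.prems(2) T by auto
        moreover have "aff_dim T' < int n"
        proof (cases "T' = {}")
          case True
          then show ?thesis by simp
        next
          case False
          then have "aff_dim T' = aff_dim T - 1"
            using good[OF T] \<open>affine T\<close> T' by (subst T', subst aff_dim_affine_Int_hyperplane) auto
          then show ?thesis
            using \<open>aff_dim T < int (Suc n)\<close> by simp
        qed
        ultimately show ?thesis
          by (simp add: T' affine_Int affine_hyperplane)
      qed
      show "Fr \<subseteq> \<Union>F'"
      proof
        fix x assume "x \<in> Fr"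
        with \<open>Fr \<subseteq> C - U\<close> have x: "x \<in> C" "x \<notin> U"
          by auto
        then have "x \<in> S"
          by (simp add: C_def)
        then obtain T where T: "T \<in> F" "x \<in> T"
          using Suc.prems(3) by blast
        from x obtain b where b: "b \<in> Basis" "\<bar>b \<bullet> (x - a)\<bar> = r"
          by (force simp: C_def U_def)
        then have "b \<bullet> x = b \<bullet> a + r \<or> b \<bullet> x = b \<bullet> a - r"
          by (auto simp: inner_diff_right)
        with T b show "x \<in> \<Union>F'"
          by (auto simp: F'_def)
      qed
    qed
    moreover have "subtopology (top_of_set S) Fr = top_of_set Fr"
      using \<open>Fr \<subseteq> C - U\<close> by (auto simp: C_def subtopology_subtopology intro!: arg_cong[of _ _ "top_of_set"])
    moreover have "a \<in> U"
      using \<open>a \<in> S\<close> r by (simp add: U_def)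
    ultimately show "\<exists>U. a \<in> U \<and> U \<subseteq> V \<and> openin (top_of_set S) U \<and>
        subtopology (top_of_set S) (top_of_set S frontier_of U) dim_le int n - 1"
      using opU \<open>U \<subseteq> V\<close> Fr_def by auto
  qed simp
  then show ?case by simp
qed

section \<open>Lower bounds from extension of maps into punctured subspaces\<close>

text \<open>The lower bound for the dimension of a ball rests on extending maps into punctured subspaces
  rather than spheres: deleting the origin keeps coordinates independent, so no normalisation is
  needed, and the property passes to finite closed unions at once.\<close>

definition extendable_avoiding_zero :: "'a::euclidean_space set \<Rightarrow> 'b::euclidean_space set \<Rightarrow> bool" where
  "extendable_avoiding_zero X S \<longleftrightarrow>
     (\<forall>A f. closedin (top_of_set X) A \<and> continuous_on A f \<and> f ` A \<subseteq> S - {0} \<longrightarrow>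
        (\<exists>g. continuous_on X g \<and> g ` X \<subseteq> S - {0} \<and> (\<forall>x\<in>A. g x = f x)))"

lemma extendable_avoiding_zeroE:
  assumes "extendable_avoiding_zero X S" "closedin (top_of_set X) A" "continuous_on A f" "f ` A \<subseteq> S - {0}"
  obtains g where "continuous_on X g" "g ` X \<subseteq> S - {0}" "\<And>x. x \<in> A \<Longrightarrow> g x = f x"
  using assms unfolding extendable_avoiding_zero_def by metis

text \<open>Two successive extensions: first over \<open>X\<close>, then, after gluing with
  \<open>f\<close> on \<open>A\<close>, over \<open>Y\<close>. Gluing preserves continuity because
  all the sets involved are closed.\<close>

lemma extendable_avoiding_zero_Un:
  assumes X: "extendable_avoiding_zero X S" "closed X" and Y: "extendable_avoiding_zero Y S" "closed Y"
  shows "extendable_avoiding_zero (X \<union> Y) S"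
  unfolding extendable_avoiding_zero_def
proof (intro allI impI)
  fix A f
  assume "closedin (top_of_set (X \<union> Y)) A \<and> continuous_on A f \<and> f ` A \<subseteq> S - {0}"
  then have A: "closed A" "A \<subseteq> X \<union> Y" and f: "continuous_on A f" "f ` A \<subseteq> S - {0}"
    using X Y closedin_closed_trans closedin_imp_subset by (blast intro: closedin_closed_trans)+
  obtain g where g: "continuous_on X g" "g ` X \<subseteq> S - {0}" "\<And>x. x \<in> A \<inter> X \<Longrightarrow> g x = f x"
  proof (rule extendable_avoiding_zeroE[OF X(1)])
    show "closedin (top_of_set X) (A \<inter> X)"
      using A X by (simp add: closed_subset closed_Int)
    show "continuous_on (A \<inter> X) f"
      by (rule continuous_on_subset[OF f(1)]) auto
    show "f ` (A \<inter> X) \<subseteq> S - {0}"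
      using f by blast
  qed (rule that)
  define f' where "f' x = (if x \<in> A then f x else g x)" for x
  have f': "continuous_on (A \<union> X) f'"
    unfolding f'_def by (rule continuous_on_cases[OF A(1) X(2) f(1) g(1)]) (use g in auto)
  have f'S: "f' ` (A \<union> X) \<subseteq> S - {0}"
    using f(2) g(2) by (auto simp: f'_def image_subset_iff)
  obtain h where h: "continuous_on Y h" "h ` Y \<subseteq> S - {0}" "\<And>x. x \<in> (A \<union> X) \<inter> Y \<Longrightarrow> h x = f' x"
  proof (rule extendable_avoiding_zeroE[OF Y(1)])
    show "closedin (top_of_set Y) ((A \<union> X) \<inter> Y)"
      using A X Y by (simp add: closed_subset closed_Int closed_Un)
    show "continuous_on ((A \<union> X) \<inter> Y) f'"
      by (rule continuous_on_subset[OF f']) auto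
    show "f' ` ((A \<union> X) \<inter> Y) \<subseteq> S - {0}"
      using f'S by auto
  qed (rule that)
  define k where "k x = (if x \<in> A \<union> X then f' x else h x)" for x
  have "continuous_on ((A \<union> X) \<union> Y) k"
    unfolding k_def by (rule continuous_on_cases[OF _ Y(2) f' h(1)]) (use A X h in \<open>auto simp: closed_Un\<close>)
  moreover have "k ` (X \<union> Y) \<subseteq> S - {0}"
    using f'S h(2) A by (auto simp: k_def image_subset_iff)
  moreover have "\<forall>x\<in>A. k x = f x"
    by (simp add: k_def f'_def)
  ultimately show "\<exists>g. continuous_on (X \<union> Y) g \<and> g ` (X \<union> Y) \<subseteq> S - {0} \<and> (\<forall>x\<in>A. g x = f x)"
    using A(2) by (intro exI[of _ k]) (auto simp: sup.absorb2 Un_assoc)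
qed

lemma extendable_avoiding_zero_Union:
  assumes "finite F" "\<And>X. X \<in> F \<Longrightarrow> closed X \<and> extendable_avoiding_zero X S"
  shows "extendable_avoiding_zero (\<Union>F) S"
  using assms
proof (induction rule: finite_induct)
  case empty
  then show ?case
    by (auto simp: extendable_avoiding_zero_def)
next
  case (insert X F)
  then have "extendable_avoiding_zero (X \<union> \<Union>F) S"
    by (intro extendable_avoiding_zero_Un) auto
  then show ?case by simp
qed

text \<open>The removed set is the closed ray from 0 in direction \<open>-e\<close>. What remains is
  open in \<open>S\<close>, hence an ANR, and starlike about \<open>e\<close>, hence
  contractible.\<close>

lemma AR_subspace_minus_ray:
  fixes S :: "'a::euclidean_space set"
  assumes "subspace S" "e \<in> S" "norm e = 1"
  shows "AR (S - {x. x = (x \<bullet> e) *\<^sub>R e \<and> x \<bullet> e \<le> 0})" (is "AR (S - ?R)")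
proof -
  have "closed ?R"
    by (intro closed_Collect_conj closed_Collect_eq closed_Collect_le continuous_intros)
  then have "openin (top_of_set S) (S - ?R)"
    by (simp add: Diff_eq openin_open_Int open_Compl)
  then have "ANR (S - ?R)"
    by (meson ANR_openin assms(1) convex_imp_ANR subspace_imp_convex)
  moreover have ee: "e \<bullet> e = 1"
    using assms(3) by (simp add: dot_square_norm)
  then have e: "e \<in> S - ?R"
    using assms by auto
  have "closed_segment e x \<subseteq> S - ?R" if x: "x \<in> S - ?R" for x
  proof
    fix y assume "y \<in> closed_segment e x"
    then obtain u where u: "0 \<le> u" "u \<le> 1" and y: "y = (1 - u) *\<^sub>R e + u *\<^sub>R x"
      by (auto simp: closed_segment_def)
    have "y \<notin> ?R"
    proof
      assume "y \<in> ?R"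
      then have R: "y = (y \<bullet> e) *\<^sub>R e" "y \<bullet> e \<le> 0"
        by auto
      have ye: "y \<bullet> e = (1 - u) + u * (x \<bullet> e)"
        by (simp add: y inner_add_left ee)
      with R u have "u \<noteq> 0"
        by auto
      have "u *\<^sub>R x = u *\<^sub>R ((x \<bullet> e) *\<^sub>R e)"
        using R(1) unfolding ye by (simp add: y algebra_simps)
      with \<open>u \<noteq> 0\<close> have "x = (x \<bullet> e) *\<^sub>R e"
        by (metis scaleR_cancel_left)
      moreover have "u * (x \<bullet> e) \<le> 0"
        using R(2) ye u by linarith
      then have "x \<bullet> e \<le> 0"
        using u \<open>u \<noteq> 0\<close> by (simp add: mult_le_0_iff)
      ultimately show False
        using x by auto
    qed
    moreover have "y \<in> S"
      using assms x by (auto simp: y intro!: subspace_add subspace_scale)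
    ultimately show "y \<in> S - ?R"
      by simp
  qed
  with e have "starlike (S - ?R)"
    unfolding starlike_def by blast
  ultimately show ?thesis
    using e by (metis (no_types, lifting) AR_ANR starlike_imp_contractible empty_iff)
qed

text \<open>The induction splits \<open>X\<close> along a partition \<open>L\<close>, of smaller dimension, between the points that \<open>f\<close>
  maps to the two rays spanned by a unit vector \<open>e\<close>. On \<open>L\<close> the part of \<open>f\<close> orthogonal to \<open>e\<close> extends
  without zeros; on either side of \<open>L\<close> the values avoid a ray, whose complement is an absolute
  retract.\<close>

lemma dim_le_extendable_avoiding_zero:
  fixes X :: "'a::euclidean_space set" and S :: "'b::euclidean_space set"
  assumes "compact X" and "top_of_set X dim_le int (dim S) - 1" and "subspace S"
  shows "extendable_avoiding_zero X S"
  using assms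
proof (induction "dim S" arbitrary: X S)
  \<comment> \<open>With \<open>dim S = 0\<close> the dimension of \<open>X\<close> is at most -1,
    so there is no point to extend to.\<close>
  case 0
  then have "X = {}"
    by (auto simp: subtopology_trivial_iff simp flip: "0.hyps")
  then show ?case
    by (simp add: extendable_avoiding_zero_def)
next
  case (Suc n)
  have "dim S > 0"
    using Suc.hyps(2) by simp
  then obtain e0 where e0: "e0 \<in> S" "e0 \<noteq> 0"
    by (metis dim_eq_0 less_numeral_extra(3) singletonI subset_iff)
  define e where "e = e0 /\<^sub>R norm e0"
  have e: "e \<in> S" "norm e = 1"
    using e0 \<open>subspace S\<close> by (auto simp: e_def subspace_scale)
  then have ee: "e \<bullet> e = 1"
    by (simp add: dot_square_norm)
  define T where "T = S \<inter> {x. e \<bullet> x = 0}"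
  have "subspace T"
    using \<open>subspace S\<close> by (simp add: T_def subspace_hyperplane subspace_inter)
  have "dim T = n"
  proof -
    have "S \<inter> {x. e \<bullet> x = 0} \<noteq> {}" "\<not> S \<subseteq> {x. e \<bullet> x = 0}"
      using subspace_0[OF \<open>subspace S\<close>] e ee by auto
    then have "aff_dim T = aff_dim S - 1"
      unfolding T_def
      using \<open>subspace S\<close> by (simp add: aff_dim_affine_Int_hyperplane subspace_imp_affine)
    then show ?thesis
      using Suc.hyps(2) \<open>subspace S\<close> \<open>subspace T\<close> by (simp add: aff_dim_subspace)
  qed
  define P where "P x = x - (x \<bullet> e) *\<^sub>R e" for x
  have P_T: "P x \<in> T" if "x \<in> S" for x
    using that \<open>subspace S\<close> e ee
    by (auto simp: P_def T_def inner_diff_right inner_commute subspace_diff subspace_scale)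
  have contP: "continuous_on Y (\<lambda>x. P (f x))" if "continuous_on Y f" for Y :: "'a set" and f
    unfolding P_def using that by (intro continuous_intros)
  have P_split: "x = (x \<bullet> e) *\<^sub>R e + P x" for x
    by (simp add: P_def)
  show ?case
    unfolding extendable_avoiding_zero_def
  proof (intro allI impI)
    fix A f
    assume "closedin (top_of_set X) A \<and> continuous_on A f \<and> f ` A \<subseteq> S - {0}"
    then have A: "closedin (top_of_set X) A" "A \<subseteq> X" and f: "continuous_on A f" "f ` A \<subseteq> S - {0}"
      using closedin_imp_subset by blast+
    have "closed A" "compact A" "closed X"
      using A(1) Suc.prems(1) closedin_compact compact_imp_closed by blast+
    have clA: "closed {x \<in> A. P (f x) = 0 \<and> Q (f x \<bullet> e)}" if "Q = (\<lambda>t. t \<le> 0) \<or> Q = (\<lambda>t. t \<ge> 0)" for Q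
    proof -
      have 1: "closedin (top_of_set A) (A \<inter> f -` {x. P x = 0 \<and> Q (x \<bullet> e)})"
      proof (rule continuous_closedin_preimage[OF f(1)])
        show "closed {x. P x = 0 \<and> Q (x \<bullet> e)}"
          using that unfolding P_def
          by (auto intro!: closed_Collect_conj closed_Collect_eq closed_Collect_le continuous_intros)
      qed
      moreover have "A \<inter> f -` {x. P x = 0 \<and> Q (x \<bullet> e)} = {x \<in> A. P (f x) = 0 \<and> Q (f x \<bullet> e)}"
        by auto
      ultimately show ?thesis
        using \<open>closed A\<close> closedin_closed_trans by metis
    qed
    \<comment> \<open>\<open>A0\<close> and \<open>B0\<close> collect the points that
      \<open>f\<close> maps to the rays of \<open>e\<close> and \<open>-e\<close>. A common point
      would be a zero of \<open>f\<close>.\<close>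
    define A0 where "A0 = {x \<in> A. P (f x) = 0 \<and> f x \<bullet> e \<ge> 0}"
    define B0 where "B0 = {x \<in> A. P (f x) = 0 \<and> f x \<bullet> e \<le> 0}"
    have "closed A0" "closed B0"
      unfolding A0_def B0_def by (rule clA; blast)+
    have "A0 \<inter> B0 = {}"
    proof (rule ccontr)
      assume "A0 \<inter> B0 \<noteq> {}"
      then obtain x where "x \<in> A" "P (f x) = 0" "f x \<bullet> e = 0"
        by (auto simp: A0_def B0_def)
      then show False
        using f(2) P_split[of "f x"] by auto
    qed
    have "\<exists>U. a \<in> U \<and> openin (top_of_set X) U \<and> top_of_set X closure_of U \<inter> B0 = {} \<and>
              subtopology (top_of_set X) (top_of_set X frontier_of U) dim_le int n - 1" if "a \<in> A0" for a
    proof -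
      have "a \<in> - B0"
        using that \<open>A0 \<inter> B0 = {}\<close> by blast
      moreover have "open (- B0)"
        using \<open>closed B0\<close> by blast
      \<comment> \<open>The closed ball has to miss \<open>B0\<close>, so that the closures of
        neighbourhoods inside the ball miss it too.\<close>
      ultimately obtain r where r: "r > 0" "cball a r \<subseteq> - B0"
        by (meson open_contains_cball)
      have "openin (top_of_set X) (X \<inter> ball a r)" "a \<in> X \<inter> ball a r"
        using that A r by (auto simp: A0_def openin_open_Int)
      moreover have "top_of_set X dim_le int n"
        using Suc.prems(2) by (simp flip: Suc.hyps(2))
      ultimately obtain U where U: "a \<in> U" "U \<subseteq> X \<inter> ball a r" "openin (top_of_set X) U"
          "subtopology (top_of_set X) (top_of_set X frontier_of U) dim_le int n - 1"
        unfolding dimension_le.simps[of _ "int n"] by blast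
      have "closedin (top_of_set X) (X \<inter> cball a r)"
        by (simp add: closedin_closed_Int)
      then have "top_of_set X closure_of U \<subseteq> X \<inter> cball a r"
        using U(2) by (intro closure_of_minimal) auto
      with U r show ?thesis
        by blast
    qed
    then obtain V where V: "\<And>a. a \<in> A0 \<Longrightarrow> a \<in> V a \<and> openin (top_of_set X) (V a) \<and>
        top_of_set X closure_of (V a) \<inter> B0 = {} \<and>
        subtopology (top_of_set X) (top_of_set X frontier_of (V a)) dim_le int n - 1"
      by metis
    have "compact A0"
      using \<open>closed A0\<close> \<open>compact A\<close> unfolding A0_def by (metis (no_types, lifting) closed_subset compact_Int_closed inf.absorb_iff2 mem_Collect_eq subsetI)
    have "\<forall>a\<in>A0. \<exists>W. open W \<and> V a = X \<inter> W"
      using V openin_open by metis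
    then obtain W where W: "\<And>a. a \<in> A0 \<Longrightarrow> open (W a) \<and> V a = X \<inter> W a"
      by metis
    have "A0 \<subseteq> (\<Union>a\<in>A0. W a)"
      using V W by blast
    then obtain I where I: "I \<subseteq> A0" "finite I" "A0 \<subseteq> (\<Union>a\<in>I. W a)"
      using compactE_image[OF \<open>compact A0\<close>] W by metis
    define U where "U = (\<Union>a\<in>I. V a)"
    have "A0 \<subseteq> X"
      using A(2) by (auto simp: A0_def)
    then have "A0 \<subseteq> U"
      using I W unfolding U_def by blast
    have opU: "openin (top_of_set X) U"
      unfolding U_def using V I by blast
    \<comment> \<open>\<open>U\<close> contains \<open>A0\<close> and its closure \<open>M\<close>
      misses \<open>B0\<close>, so the frontier \<open>L\<close> separates the two sets.\<close>
    define M where "M = top_of_set X closure_of U"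
    define L where "L = M - U"
    have M: "M = (\<Union>a\<in>I. top_of_set X closure_of (V a))"
      unfolding M_def U_def using \<open>finite I\<close> closure_of_Union[of "V ` I" "top_of_set X"] by simp
    have "M \<inter> B0 = {}"
      unfolding M using V I by blast
    have "U \<subseteq> M"
      unfolding M_def by (rule closure_of_subset[OF openin_subset[OF opU]])
    have clM: "closedin (top_of_set X) M"
      by (simp add: M_def)
    then have "closed M" "M \<subseteq> X"
      using \<open>closed X\<close> closedin_closed_trans closedin_imp_subset by blast+
    have clXU: "closed (X - U)"
      using opU \<open>closed X\<close>
      by (metis closedin_closed_trans openin_closedin_eq topspace_euclidean_subtopology)
    have "L = M \<inter> (X - U)"
      using \<open>M \<subseteq> X\<close> by (auto simp: L_def)
    then have "closed L"
      using \<open>closed M\<close> clXU by blast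
    have L_sub: "L \<subseteq> X" "L \<inter> A0 = {}" "L \<inter> B0 = {}"
      using \<open>M \<subseteq> X\<close> \<open>A0 \<subseteq> U\<close> \<open>M \<inter> B0 = {}\<close> by (auto simp: L_def)
    have extL: "extendable_avoiding_zero L T"
    proof -
      \<comment> \<open>\<open>L\<close> is covered by the finitely many frontiers of the sets
        \<open>V a\<close>, each of dimension at most \<open>dim T - 1\<close>. The induction
        hypothesis applies to these pieces, and extendability passes to their union.\<close>
      define Fr where "Fr a = L \<inter> top_of_set X frontier_of (V a)" for a
      have "extendable_avoiding_zero (\<Union>(Fr ` I)) T"
      proof (rule extendable_avoiding_zero_Union)
        fix Y assume "Y \<in> Fr ` I"
        then obtain a where a: "a \<in> I" "Y = Fr a"
          by blast
        have "closedin (top_of_set X) (top_of_set X frontier_of (V a))"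
          by (rule closedin_frontier_of)
        then have "closed (top_of_set X frontier_of (V a))"
          using \<open>closed X\<close> closedin_closed_trans by blast
        then have "closed Y"
          using \<open>closed L\<close> a by (auto simp: Fr_def)
        moreover have "Y \<subseteq> X"
          using L_sub by (auto simp: a Fr_def)
        ultimately have "compact Y"
          using Suc.prems(1) by (metis compact_Int_closed inf.absorb2)
        have "subtopology (top_of_set X) Y dim_le int n - 1"
          using V[of a] a I dimension_le_subtopologies[of "top_of_set X" "top_of_set X frontier_of (V a)" _ Y]
          by (auto simp: Fr_def)
        moreover have "subtopology (top_of_set X) Y = top_of_set Y"
          using \<open>Y \<subseteq> X\<close> by (simp add: subtopology_subtopology inf.absorb2)
        ultimately have "top_of_set Y dim_le int (dim T) - 1"
          using \<open>dim T = n\<close> by simp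
        with \<open>compact Y\<close> have "extendable_avoiding_zero Y T"
          using Suc.hyps(1)[of T Y] \<open>dim T = n\<close> \<open>subspace T\<close> by simp
        with \<open>closed Y\<close> show "closed Y \<and> extendable_avoiding_zero Y T" ..
      qed (use \<open>finite I\<close> in simp)
      moreover have "\<Union>(Fr ` I) = L"
      proof -
        have "x \<in> top_of_set X frontier_of (V a)" if "x \<in> top_of_set X closure_of (V a)" "x \<notin> U" "a \<in> I" for x a
          using that V[of a] I by (auto simp: U_def frontier_of_openin)
        then show ?thesis
          unfolding Fr_def L_def M by blast
      qed
      ultimately show ?thesis by simp
    qed
    have Pf: "P (f x) \<noteq> 0" if "x \<in> L \<inter> A" for x
    proof
      assume "P (f x) = 0"
      with that have "x \<in> A0 \<or> x \<in> B0"
        by (auto simp: A0_def B0_def)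
      with that L_sub show False
        by blast
    qed
    have clLA: "closedin (top_of_set L) (L \<inter> A)"
      using \<open>closed A\<close> by (simp add: closedin_closed_Int)
    have contLA: "continuous_on (L \<inter> A) f"
      by (rule continuous_on_subset[OF f(1)]) auto
    obtain g where g: "continuous_on L g" "g ` L \<subseteq> T - {0}" "\<And>x. x \<in> L \<inter> A \<Longrightarrow> g x = P (f x)"
    proof (rule extendable_avoiding_zeroE[OF extL clLA])
      show "continuous_on (L \<inter> A) (\<lambda>x. P (f x))"
        by (rule contP[OF contLA])
      show "(\<lambda>x. P (f x)) ` (L \<inter> A) \<subseteq> T - {0}"
        using f(2) P_T Pf by auto
    qed (rule that)
    have contfe: "continuous_on (L \<inter> A) (\<lambda>x. f x \<bullet> e)"
      by (intro continuous_intros contLA)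
    \<comment> \<open>The component along \<open>e\<close> may extend arbitrarily, zeros included:
      the orthogonal part \<open>g\<close> alone keeps the sum away from 0.\<close>
    obtain h0 :: "'a \<Rightarrow> real" where h0: "continuous_on L h0" "\<And>x. x \<in> L \<inter> A \<Longrightarrow> h0 x = f x \<bullet> e"
      using AR_imp_absolute_extensor[OF AR_UNIV contfe _ clLA] by (metis subset_UNIV)
    define h where "h x = (if x \<in> A then f x else h0 x *\<^sub>R e + g x)" for x
    have conth: "continuous_on (A \<union> L) h"
      unfolding h_def
    proof (rule continuous_on_cases[OF \<open>closed A\<close> \<open>closed L\<close> f(1)])
      show "continuous_on L (\<lambda>x. h0 x *\<^sub>R e + g x)"
        by (intro continuous_intros h0 g)
      show "\<forall>x. x \<in> A \<and> x \<notin> A \<or> x \<in> L \<and> x \<in> A \<longrightarrow> f x = h0 x *\<^sub>R e + g x"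
        using h0(2) g(3) P_split by auto
    qed
    have h_L: "P (h x) \<noteq> 0 \<and> h x \<in> S" if "x \<in> L" for x
    proof (cases "x \<in> A")
      case True
      with that show ?thesis
        using Pf[of x] f(2) by (auto simp: h_def)
    next
      case False
      have gx: "g x \<in> S" "g x \<bullet> e = 0" "g x \<noteq> 0"
        using g(2) that by (auto simp: T_def inner_commute)
      then have "P (h x) = g x"
        using False by (simp add: P_def h_def inner_add_left ee)
      with gx False show ?thesis
        using e \<open>subspace S\<close> by (auto simp: h_def intro!: subspace_add subspace_scale)
    qed
    \<comment> \<open>One argument serves both sides of \<open>L\<close>, with \<open>d = e\<close>
      on \<open>M\<close> and \<open>d = -e\<close> on \<open>X - U\<close>. The prescribed values
      there avoid the ray of \<open>-d\<close>, so they extend into its complement.\<close>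
    have half: "\<exists>k. continuous_on N k \<and> k ` N \<subseteq> S - {0} \<and> (\<forall>x \<in> (A \<inter> N) \<union> L. k x = h x)"
      if N: "closed N" "L \<subseteq> N" and d: "d = e \<or> d = -e"
        and pos: "\<And>x. x \<in> A \<inter> N \<Longrightarrow> P (f x) = 0 \<Longrightarrow> f x \<bullet> d > 0" for N d
    proof -
      let ?R = "{x. x = (x \<bullet> d) *\<^sub>R d \<and> x \<bullet> d \<le> 0}"
      have d1: "d \<in> S" "norm d = 1"
        using d e \<open>subspace S\<close> by (auto simp: subspace_neg)
      have Pd: "P x = x - (x \<bullet> d) *\<^sub>R d" for x
        using d by (auto simp: P_def)
      have clAL: "closedin (top_of_set N) (A \<inter> N \<union> L)"
        using N \<open>closed A\<close> \<open>closed L\<close> by (intro closed_subset) auto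
      have c: "continuous_on (A \<inter> N \<union> L) h"
        by (rule continuous_on_subset[OF conth]) auto
      have sub: "h ` (A \<inter> N \<union> L) \<subseteq> S - ?R"
      proof (intro image_subsetI)
        fix x assume x: "x \<in> A \<inter> N \<union> L"
        show "h x \<in> S - ?R"
        proof (cases "P (h x) = 0")
          case True
          with h_L[of x] x have "x \<in> A \<inter> N"
            by blast
          with True pos[of x] f(2) show ?thesis
            by (auto simp: h_def)
        next
          case False
          moreover have "h x \<in> S"
            using x h_L[of x] f(2) by (auto simp: h_def split: if_splits)
          ultimately show ?thesis
            by (auto simp: Pd)
        qed
      qed
      obtain k where k: "continuous_on N k" "k ` N \<subseteq> S - ?R" "\<And>x. x \<in> A \<inter> N \<union> L \<Longrightarrow> k x = h x"
      proof (rule AR_imp_absolute_extensor[OF AR_subspace_minus_ray[OF Suc.prems(3) d1] c sub clAL])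
      qed (rule that)
      moreover have "S - ?R \<subseteq> S - {0}"
        by auto
      ultimately have "k ` N \<subseteq> S - {0}"
        by (meson subset_trans)
      with k show ?thesis
        by blast
    qed
    obtain k1 where k1: "continuous_on M k1" "k1 ` M \<subseteq> S - {0}" "\<And>x. x \<in> (A \<inter> M) \<union> L \<Longrightarrow> k1 x = h x"
    proof -
      have "f x \<bullet> e > 0" if "x \<in> A \<inter> M" "P (f x) = 0" for x
        using that \<open>M \<inter> B0 = {}\<close> by (force simp: B0_def)
      then show ?thesis
        using half[of M e] \<open>closed M\<close> that by (auto simp: L_def)
    qed
    obtain k2 where k2: "continuous_on (X - U) k2" "k2 ` (X - U) \<subseteq> S - {0}" "\<And>x. x \<in> (A \<inter> (X - U)) \<union> L \<Longrightarrow> k2 x = h x"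
    proof -
      have "f x \<bullet> (-e) > 0" if "x \<in> A \<inter> (X - U)" "P (f x) = 0" for x
        using that \<open>A0 \<subseteq> U\<close> by (force simp: A0_def)
      moreover have "L \<subseteq> X - U"
        using \<open>L = M \<inter> (X - U)\<close> by simp
      ultimately have "\<exists>k. continuous_on (X - U) k \<and> k ` (X - U) \<subseteq> S - {0} \<and>
          (\<forall>x \<in> (A \<inter> (X - U)) \<union> L. k x = h x)"
        using half[of "X - U" "-e"] clXU by blast
      then show ?thesis
        using that by blast
    qed
    define k where "k x = (if x \<in> M then k1 x else k2 x)" for x
    have "continuous_on (M \<union> (X - U)) k"
      unfolding k_def
    proof (rule continuous_on_cases[OF \<open>closed M\<close> clXU k1(1) k2(1)])
      show "\<forall>x. x \<in> M \<and> x \<notin> M \<or> x \<in> X - U \<and> x \<in> M \<longrightarrow> k1 x = k2 x"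
        using k1(3) k2(3) \<open>L = M \<inter> (X - U)\<close> by auto
    qed
    moreover have X: "M \<union> (X - U) = X"
      using \<open>M \<subseteq> X\<close> \<open>U \<subseteq> M\<close> by blast
    moreover have "k ` X \<subseteq> S - {0}"
      using k1(2) k2(2) \<open>U \<subseteq> M\<close> by (auto simp: k_def image_subset_iff)
    moreover have "k x = f x" if "x \<in> A" for x
    proof -
      have "x \<in> A \<inter> M \<or> x \<in> A \<inter> (X - U) \<and> x \<notin> M"
        using that A(2) \<open>U \<subseteq> M\<close> by blast
      then show ?thesis
        using k1(3)[of x] k2(3)[of x] by (auto simp: k_def h_def)
    qed
    ultimately show "\<exists>g. continuous_on X g \<and> g ` X \<subseteq> S - {0} \<and> (\<forall>x\<in>A. g x = f x)"
      by auto
  qed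
qed

text \<open>The map \<open>p\<close> inverts \<open>f\<close> on the ball, so the dimension bound
  would pass from \<open>U\<close> to the ball of \<open>S\<close>. Then the identity of the sphere
  would extend over the ball without zeros, which Brouwer's theorem forbids.\<close>

lemma not_dim_le_embedded_ball:
  fixes S :: "'b::euclidean_space set" and U :: "'a::euclidean_space set"
  assumes "subspace S" "r > 0"
    and f: "continuous_on (S \<inter> cball 0 r) f" "f ` (S \<inter> cball 0 r) \<subseteq> U"
    and p: "continuous_on U p" "\<And>x. x \<in> S \<inter> cball 0 r \<Longrightarrow> p (f x) = x"
  shows "\<not> top_of_set U dim_le int (dim S) - 1"
proof
  let ?D = "S \<inter> cball 0 r"
  assume "top_of_set U dim_le int (dim S) - 1"
  then have "subtopology (top_of_set U) (f ` ?D) dim_le int (dim S) - 1"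
    by (rule dimension_le_subtopology)
  moreover have "subtopology (top_of_set U) (f ` ?D) = top_of_set (f ` ?D)"
    using f(2) by (simp add: subtopology_subtopology inf.absorb2)
  ultimately have "top_of_set (f ` ?D) dim_le int (dim S) - 1"
    by simp
  moreover have "homeomorphism ?D (f ` ?D) f p"
    using f p by (auto intro!: homeomorphismI intro: continuous_on_subset)
  then have "top_of_set ?D homeomorphic_space top_of_set (f ` ?D)"
    unfolding homeomorphic_space_def homeomorphic_maps_def homeomorphism_def
    by (intro exI[of _ f] exI[of _ p]) auto
  ultimately have "top_of_set ?D dim_le int (dim S) - 1"
    using homeomorphic_space_dimension_le by blast
  moreover have "compact ?D"
    using closed_subspace[OF \<open>subspace S\<close>] by (simp add: closed_Int_compact)
  ultimately have ext: "extendable_avoiding_zero ?D S"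
    using \<open>subspace S\<close> by (intro dim_le_extendable_avoiding_zero)
  have "closedin (top_of_set ?D) (?D \<inter> sphere 0 r)"
    by (simp add: closedin_closed_Int)
  then obtain g where g: "continuous_on ?D g" "g ` ?D \<subseteq> S - {0}" "\<And>x. x \<in> ?D \<inter> sphere 0 r \<Longrightarrow> g x = x"
  proof (rule extendable_avoiding_zeroE[OF ext])
    show "(\<lambda>x. x) ` (?D \<inter> sphere 0 r) \<subseteq> S - {0}"
      using \<open>r > 0\<close> by auto
  qed (auto intro: that)
  \<comment> \<open>The map is the antipode of the radial projection of \<open>g\<close> to the
    sphere. Its fixed point lies on the sphere, where \<open>g\<close> is the identity, and so
    equals its own negative.\<close>
  obtain x where x: "x \<in> ?D" "- (r / norm (g x)) *\<^sub>R g x = x"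
  proof (rule brouwer[of ?D "\<lambda>x. - (r / norm (g x)) *\<^sub>R g x"])
    show "convex ?D" "?D \<noteq> {}"
      using \<open>subspace S\<close> \<open>r > 0\<close> subspace_0[of S] by (auto simp: convex_Int subspace_imp_convex)
    show "continuous_on ?D (\<lambda>x. - (r / norm (g x)) *\<^sub>R g x)"
      using g(2) by (intro continuous_intros g(1)) auto
    show "(\<lambda>x. - (r / norm (g x)) *\<^sub>R g x) \<in> ?D \<rightarrow> ?D"
    proof
      fix x assume "x \<in> ?D"
      then have "g x \<in> S - {0}"
        using g(2) by blast
      then show "- (r / norm (g x)) *\<^sub>R g x \<in> ?D"
        using \<open>r > 0\<close> \<open>subspace S\<close> by (auto intro!: subspace_scale subspace_neg)
    qed
  qed (use \<open>compact ?D\<close> in auto)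
  have "g x \<noteq> 0"
    using g(2) x(1) by blast
  then have "norm x = r"
    using \<open>r > 0\<close> by (subst x(2)[symmetric]) simp
  then have "g x = x"
    using g(3) x(1) by simp
  with x(2) \<open>norm x = r\<close> \<open>r > 0\<close> have "- x = x"
    by simp
  then show False
    using \<open>norm x = r\<close> \<open>r > 0\<close> by (simp add: neg_eq_iff_add_eq_0 flip: scaleR_2)
qed

section \<open>Tropical spans and factorisations\<close>

lemma continuous_on_MAX:
  fixes f :: "'i \<Rightarrow> 'a::topological_space \<Rightarrow> real"
  assumes "finite I" "I \<noteq> {}" "\<And>i. i \<in> I \<Longrightarrow> continuous_on S (f i)"
  shows "continuous_on S (\<lambda>x. MAX i\<in>I. f i x)"
  using assms
proof (induction rule: finite_ne_induct)
  case (insert i I)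
  then have "(\<lambda>x. MAX j\<in>insert i I. f j x) = (\<lambda>x. max (f i x) (MAX j\<in>I. f j x))"
    by (simp add: fun_eq_iff)
  moreover have "continuous_on S (\<lambda>x. max (f i x) (MAX j\<in>I. f j x))"
    using insert by (intro continuous_on_max) auto
  ultimately show ?case
    by (simp only:)
qed simp

text \<open>In this form, an upper bound that is attained, identities between maxima reduce to
  linear arithmetic.\<close>

lemma eq_MAX_iff:
  fixes f :: "'i \<Rightarrow> real"
  assumes "finite I" "I \<noteq> {}"
  shows "y = (MAX i\<in>I. f i) \<longleftrightarrow> (\<forall>i\<in>I. f i \<le> y) \<and> (\<exists>i\<in>I. y = f i)"
proof -
  have "y = (MAX i\<in>I. f i) \<longleftrightarrow> Max (f ` I) = y"
    by auto
  also have "\<dots> \<longleftrightarrow> y \<in> f ` I \<and> (\<forall>a\<in>f ` I. a \<le> y)"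
    using assms by (intro Max_eq_iff) auto
  finally show ?thesis
    by (simp add: image_iff conj_commute)
qed

lemma trop_closed_MAX:
  assumes "trop_closed X" "finite I" "I \<noteq> {}" "\<And>i. i \<in> I \<Longrightarrow> f i \<in> X"
  shows "(\<chi> m. MAX i\<in>I. f i $ m) \<in> X"
  using assms(2,3,4)
proof (induction rule: finite_ne_induct)
  case (insert i I)
  then have "(\<chi> m. MAX j\<in>insert i I. f j $ m) = trop_add (f i) (\<chi> m. MAX j\<in>I. f j $ m)"
    by (simp add: trop_add_def vec_eq_iff)
  with insert assms(1) show ?case
    by (simp add: trop_closed_def)
qed simp

text \<open>The right side unfolds \<open>y = max_i (f i + x i)\<close>. All coefficients are real,
  so every generator takes part in every combination; a single generator is still of this form
  because the other coefficients can be taken small.\<close>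

lemma mem_trop_hull_iff:
  fixes f :: "'i \<Rightarrow> real ^ 'n"
  assumes I: "finite I" "I \<noteq> {}"
  shows "y \<in> trop_closed hull (f ` I) \<longleftrightarrow>
    (\<exists>x. \<forall>m. (\<forall>i\<in>I. f i $ m + x i \<le> y $ m) \<and> (\<exists>i\<in>I. y $ m = f i $ m + x i))"
proof -
  define P where "P y x \<longleftrightarrow> (\<forall>m. (\<forall>i\<in>I. f i $ m + x i \<le> y $ m) \<and> (\<exists>i\<in>I. y $ m = f i $ m + x i))"
    for y x
  have P_MAX: "P y x \<longleftrightarrow> y = (\<chi> m. MAX i\<in>I. f i $ m + x i)" for x y
    by (simp add: P_def vec_eq_iff eq_MAX_iff[OF I])
  have "trop_closed hull (f ` I) = {y. \<exists>x. P y x}"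
  proof (rule hull_unique)
    show "f ` I \<subseteq> {y. \<exists>x. P y x}"
    proof clarify
      fix i assume "i \<in> I"
      \<comment> \<open>The greatest multiple of \<open>f j\<close> below \<open>f i\<close>; it
        stands in for a zero coefficient.\<close>
      define x where "x j = (MIN m. f i $ m - f j $ m)" for j
      have "x j \<le> f i $ m - f j $ m" for j m
        unfolding x_def by (intro Min_le) auto
      then have "f j $ m + x j \<le> f i $ m" for j m
        by (simp add: algebra_simps)
      moreover have "x i = 0"
        by (simp add: x_def)
      ultimately have "P (f i) x"
        using \<open>i \<in> I\<close> unfolding P_def by force
      then show "\<exists>x. P (f i) x"
        by blast
    qed
    show "trop_closed {y. \<exists>x. P y x}"
      unfolding trop_closed_def
    proof (intro conjI ballI allI)
      fix y y' assume "y \<in> {y. \<exists>x. P y x}" "y' \<in> {y. \<exists>x. P y x}"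
      then obtain x x' where x: "P y x" "P y' x'"
        by blast
      have "P (trop_add y y') (\<lambda>i. max (x i) (x' i))"
        unfolding P_def
      proof (intro allI conjI ballI)
        fix m
        show "f i $ m + max (x i) (x' i) \<le> trop_add y y' $ m" if "i \<in> I" for i
        proof -
          have "f i $ m + x i \<le> y $ m" "f i $ m + x' i \<le> y' $ m"
            using x that by (auto simp: P_def)
          then show ?thesis
            by (auto simp: trop_add_def max_def)
        qed
        obtain i j where "i \<in> I" "y $ m = f i $ m + x i" "j \<in> I" "y' $ m = f j $ m + x' j"
          using x by (meson P_def)
        moreover have "f j $ m + x j \<le> y $ m" "f i $ m + x' i \<le> y' $ m"
          using x \<open>i \<in> I\<close> \<open>j \<in> I\<close> by (auto simp: P_def)
        ultimately have "trop_add y y' $ m = f i $ m + max (x i) (x' i) \<or>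
            trop_add y y' $ m = f j $ m + max (x j) (x' j)"
          by (auto simp: trop_add_def max_def)
        with \<open>i \<in> I\<close> \<open>j \<in> I\<close> show "\<exists>i\<in>I. trop_add y y' $ m = f i $ m + max (x i) (x' i)"
          by blast
      qed
      then show "trop_add y y' \<in> {y. \<exists>x. P y x}"
        by blast
    next
      fix c y assume "y \<in> {y. \<exists>x. P y x}"
      then obtain x where "P y x"
        by blast
      then have "P (trop_scale c y) (\<lambda>i. c + x i)"
        by (simp add: P_def trop_scale_def algebra_simps)
      then show "trop_scale c y \<in> {y. \<exists>x. P y x}"
        by blast
    qed
    fix X assume X: "f ` I \<subseteq> X" "trop_closed X"
    show "{y. \<exists>x. P y x} \<subseteq> X"
    proof clarify
      fix y x assume "P y x"
      then have "y = (\<chi> m. MAX i\<in>I. trop_scale (x i) (f i) $ m)"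
        by (simp add: P_MAX trop_scale_def add.commute)
      moreover have "trop_scale (x i) (f i) \<in> X" if "i \<in> I" for i
        using X that by (auto simp: trop_closed_def)
      ultimately show "y \<in> X"
        using trop_closed_MAX[OF X(2) I] by metis
    qed
  qed
  then show ?thesis
    by (simp add: P_def)
qed

lemma trop_closed_trop_hull: "trop_closed (trop_closed hull G)"
  by (rule hull_in) (auto simp: trop_closed_def)

lemma trop_hull_empty [simp]: "trop_closed hull {} = {}"
  by (rule hull_unique) (auto simp: trop_closed_def)

section \<open>Row spaces, column spaces and matrix products\<close>

lemma columns_eq_range: "columns A = range (\<lambda>j. column j A)"
  by (auto simp: columns_def)

lemma mem_column_space_iff:
  fixes A :: "real ^ 'n ^ 'm"
  shows "y \<in> column_space A \<longleftrightarrow>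
    (\<exists>x. \<forall>i. (\<forall>j. A $ i $ j + x j \<le> y $ i) \<and> (\<exists>j. y $ i = A $ i $ j + x j))"
  by (simp add: column_space_def columns_eq_range mem_trop_hull_iff column_def)

lemma row_space_transpose: "row_space (transpose A) = column_space A"
  by (simp add: row_space_def column_space_def)

lemma column_in_column_space: "column j A \<in> column_space A"
  unfolding column_space_def by (rule hull_inc) (auto simp: columns_def)

lemma trop_mult_component:
  fixes A :: "real ^ 'm ^ 'k" and B :: "real ^ 'n ^ 'm"
  shows "A $ i $ k + B $ k $ j \<le> trop_mult A B $ i $ j"
    and "\<exists>k. trop_mult A B $ i $ j = A $ i $ k + B $ k $ j"
  using eq_MAX_iff[of UNIV "trop_mult A B $ i $ j" "\<lambda>k. A $ i $ k + B $ k $ j"]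
  by (auto simp: trop_mult_def)

lemma trop_mult_mult_eq_iff:
  "trop_mult (trop_mult A B) C = D \<longleftrightarrow>
    (\<forall>i j. (\<forall>k l. A $ i $ k + B $ k $ l + C $ l $ j \<le> D $ i $ j) \<and>
           (\<exists>k l. D $ i $ j = A $ i $ k + B $ k $ l + C $ l $ j))" (is "_ \<longleftrightarrow> ?R")
proof -
  have le: "A $ i $ k + B $ k $ l + C $ l $ j \<le> trop_mult (trop_mult A B) C $ i $ j" for i j k l
    using trop_mult_component(1)[of A i k B l] trop_mult_component(1)[of "trop_mult A B" i l C j]
    by linarith
  moreover have ex: "\<exists>k l. trop_mult (trop_mult A B) C $ i $ j = A $ i $ k + B $ k $ l + C $ l $ j" for i j
    by (metis trop_mult_component(2))
  ultimately have "?R" if "trop_mult (trop_mult A B) C = D"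
    using that by blast
  moreover have "trop_mult (trop_mult A B) C = D" if ?R
  proof -
    have "trop_mult (trop_mult A B) C $ i $ j = D $ i $ j" for i j
    proof (rule antisym)
      show "trop_mult (trop_mult A B) C $ i $ j \<le> D $ i $ j"
        by (metis ex that)
      show "D $ i $ j \<le> trop_mult (trop_mult A B) C $ i $ j"
        by (metis le that)
    qed
    then show ?thesis
      by (simp add: vec_eq_iff)
  qed
  ultimately show ?thesis
    by blast
qed

lemma von_neumann_regular_transpose:
  assumes "von_neumann_regular A"
  shows "von_neumann_regular (transpose A)"
proof -
  obtain B where "trop_mult (trop_mult A B) A = A"
    using assms by (auto simp: von_neumann_regular_def)
  then have le: "A $ i $ k + B $ k $ l + A $ l $ j \<le> A $ i $ j"
    and ex: "\<exists>k l. A $ i $ j = A $ i $ k + B $ k $ l + A $ l $ j" for i j k l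
    by (auto simp: trop_mult_mult_eq_iff)
  have "trop_mult (trop_mult (transpose A) (transpose B)) (transpose A) = transpose A"
    unfolding trop_mult_mult_eq_iff
  proof (intro allI conjI)
    fix i j k l
    show "transpose A $ i $ k + transpose B $ k $ l + transpose A $ l $ j \<le> transpose A $ i $ j"
      using le[of j l k i] by (simp add: transpose_def)
  next
    fix i j
    obtain k l where "A $ j $ i = A $ j $ k + B $ k $ l + A $ l $ i"
      using ex by blast
    then show "\<exists>k l. transpose A $ i $ j = transpose A $ i $ k + transpose B $ k $ l + transpose A $ l $ j"
      by (intro exI[of _ l] exI[of _ k]) (simp add: transpose_def)
  qed
  then show ?thesis
    by (auto simp: von_neumann_regular_def)
qed

lemma generator_dim_le:
  assumes "finite G" "trop_closed hull G = X"
  shows "generator_dim X \<le> enat (card G)"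
  unfolding generator_dim_def by (rule INF_lower2[of G]) (use assms in auto)

lemma generator_dim_attained:
  assumes "generator_dim X = enat k"
  obtains G where "finite G" "card G = k" "trop_closed hull G = X"
proof -
  let ?\<G> = "{G. trop_closed hull G = X}"
  let ?c = "\<lambda>G. if finite G then enat (card G) else \<infinity>"
  have "?c ` ?\<G> \<noteq> {}"
    using assms by (auto simp: generator_dim_def Inf_enat_def)
  then have "Inf (?c ` ?\<G>) \<in> ?c ` ?\<G>"
    by (meson wellorder_InfI ex_in_conv)
  then obtain G where "trop_closed hull G = X" "?c G = enat k"
    using assms unfolding generator_dim_def by auto
  then show ?thesis
    using that by (auto split: if_splits)
qed

section \<open>Dimension bounds for tropical spans\<close>

text \<open>Once a generator \<open>\<rho> m\<close> attaining the maximum is chosen for each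
  coordinate \<open>m\<close>, a tropical combination depends affinely on its coefficients, and only
  on those of the chosen generators.\<close>

lemma affine_slab:
  fixes c :: "real ^ 'n" and \<rho> :: "'n \<Rightarrow> 'i"
  defines "T \<equiv> range (\<lambda>z. \<chi> m. c $ m + z (\<rho> m))"
  shows "affine T" "aff_dim T \<le> int (card (range \<rho>))"
proof -
  define L :: "(real ^ 'n) set" where "L = range (\<lambda>z. \<chi> m. z (\<rho> m))"
  have T: "T = (+) c ` L"
    by (auto simp: T_def L_def image_image vec_eq_iff intro!: image_cong)
  have "subspace L"
    unfolding subspace_def
  proof (intro conjI ballI allI)
    show "0 \<in> L"
      by (auto simp: L_def vec_eq_iff intro!: image_eqI[of _ _ "\<lambda>_. 0"])
    show "x + y \<in> L" if xy: "x \<in> L" "y \<in> L" for x y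
    proof -
      obtain z z' where "x = (\<chi> m. z (\<rho> m))" "y = (\<chi> m. z' (\<rho> m))"
        using xy by (auto simp: L_def)
      then show ?thesis
        by (auto simp: L_def vec_eq_iff intro!: image_eqI[of _ _ "\<lambda>i. z i + z' i"])
    qed
    show "r *\<^sub>R x \<in> L" if x: "x \<in> L" for x r
    proof -
      obtain z where "x = (\<chi> m. z (\<rho> m))"
        using x by (auto simp: L_def)
      then show ?thesis
        by (auto simp: L_def vec_eq_iff intro!: image_eqI[of _ _ "\<lambda>i. r * z i"])
    qed
  qed
  then show "affine T"
    unfolding T using affine_translation subspace_imp_affine by blast
  \<comment> \<open>The indicator vectors of the fibres of \<open>\<rho>\<close> span the direction
    space \<open>L\<close>.\<close>
  define b :: "'i \<Rightarrow> real ^ 'n" where "b h = (\<chi> m. if \<rho> m = h then 1 else 0)" for h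
  have "L \<subseteq> span (b ` range \<rho>)"
  proof
    fix x assume "x \<in> L"
    then obtain z where z: "x = (\<chi> m. z (\<rho> m))"
      by (auto simp: L_def)
    have "x = (\<Sum>h\<in>range \<rho>. z h *\<^sub>R b h)"
      by (simp add: z vec_eq_iff b_def if_distrib[of "(*) _"] cong: if_cong)
    also have "\<dots> \<in> span (b ` range \<rho>)"
      by (intro span_sum span_scale span_base) auto
    finally show "x \<in> span (b ` range \<rho>)" .
  qed
  then have "dim L \<le> card (b ` range \<rho>)"
    by (intro dim_le_card) auto
  also have "\<dots> \<le> card (range \<rho>)"
    by (intro card_image_le) auto
  finally show "aff_dim T \<le> int (card (range \<rho>))"
    using \<open>subspace L\<close> by (simp add: T aff_dim_translation_eq aff_dim_subspace)
qed

lemma dim_le_slab_cover: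
  fixes c :: "'p \<Rightarrow> real ^ 'n" and \<rho> :: "'p \<Rightarrow> 'n \<Rightarrow> 'i"
  assumes "finite P" "\<And>p. p \<in> P \<Longrightarrow> card (range (\<rho> p)) \<le> d"
    and "\<And>y. y \<in> U \<Longrightarrow> \<exists>p\<in>P. \<exists>z. \<forall>m. y $ m = c p $ m + z (\<rho> p m)"
  shows "top_of_set U dim_le int d"
proof -
  define F where "F = (\<lambda>p. range (\<lambda>z. \<chi> m. c p $ m + z (\<rho> p m))) ` P"
  \<comment> \<open>The covering lemma takes a strict bound on the dimension of the pieces, hence
    \<open>Suc d\<close>.\<close>
  have "top_of_set U dim_le int (Suc d) - 1"
  proof (rule dim_le_affine_cover)
    show "finite F"
      using assms(1) by (simp add: F_def)
    show "affine T \<and> aff_dim T < int (Suc d)" if TF: "T \<in> F" for T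
    proof -
      obtain p where "p \<in> P" and T: "T = range (\<lambda>z. \<chi> m. c p $ m + z (\<rho> p m))"
        using TF by (auto simp: F_def)
      then show ?thesis
        using affine_slab[of "c p" "\<rho> p"] assms(2)[of p] by simp
    qed
    show "U \<subseteq> \<Union>F"
      using assms(3) by (fastforce simp: F_def vec_eq_iff image_iff)
  qed
  then show ?thesis by simp
qed

text \<open>The finitely many choices of attaining generators cover the hull by slabs with at most
  \<open>card I\<close> parameters.\<close>

lemma dim_le_trop_hull:
  fixes f :: "'i \<Rightarrow> real ^ 'n"
  assumes "finite I" "U \<subseteq> trop_closed hull (f ` I)"
  shows "top_of_set U dim_le int (card I)"
proof (cases "I = {}")
  case True
  with assms(2) have "top_of_set U dim_le -1"
    by (simp add: subtopology_trivial_iff)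
  then show ?thesis
    by (rule dimension_le_mono) simp
next
  case False
  show ?thesis
  proof (rule dim_le_slab_cover)
    show "finite {\<rho> :: 'n \<Rightarrow> 'i. range \<rho> \<subseteq> I}"
      using finite_PiE[of "UNIV :: 'n set" "\<lambda>_. I"] assms(1) by (simp add: PiE_UNIV_domain Pi_def image_subset_iff)
    show "card (range \<rho>) \<le> card I" if "\<rho> \<in> {\<rho> :: 'n \<Rightarrow> 'i. range \<rho> \<subseteq> I}" for \<rho>
      using that assms(1) by (simp add: card_mono)
    show "\<exists>\<rho>\<in>{\<rho>. range \<rho> \<subseteq> I}. \<exists>z. \<forall>m. y $ m = (\<chi> m. f (\<rho> m) $ m) $ m + z (\<rho> m)" if y: "y \<in> U" for y
    proof -
      have "y \<in> trop_closed hull (f ` I)"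
        using assms(2) y by blast
      then obtain x where x: "\<And>m. \<exists>i\<in>I. y $ m = f i $ m + x i"
        unfolding mem_trop_hull_iff[OF \<open>finite I\<close> False] by blast
      then obtain \<rho> where "\<And>m. \<rho> m \<in> I \<and> y $ m = f (\<rho> m) $ m + x (\<rho> m)"
        by metis
      then show ?thesis
        by (intro bexI[of _ \<rho>] exI[of _ x]) auto
    qed
  qed
qed

text \<open>An equation \<open>z i = z j + d\<close> eliminates the parameter \<open>z i\<close>, so
  each slab loses one dimension; finitely many equations still give a finite cover.\<close>

lemma dim_le_trop_hull_hyperplanes:
  fixes f :: "'i \<Rightarrow> real ^ 'n"
  assumes "finite I" "finite D"
    and U: "\<And>y. y \<in> U \<Longrightarrow> \<exists>z. (\<forall>m. \<exists>i\<in>I. y $ m = f i $ m + z i) \<and>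
                  (\<exists>i\<in>I. \<exists>j\<in>I. i \<noteq> j \<and> z i - z j \<in> D)"
  shows "top_of_set U dim_le int (card I - 1)"
proof (rule dim_le_slab_cover)
  let ?P = "{\<tau> :: 'n \<Rightarrow> 'i. range \<tau> \<subseteq> I} \<times> {(i, j). i \<in> I \<and> j \<in> I \<and> i \<noteq> j} \<times> D"
  \<comment> \<open>Where the choice was \<open>i\<close>, the parameter \<open>z j\<close> is read
    instead and \<open>?c\<close> adds the offset \<open>d\<close>. Thus \<open>i\<close> leaves the
    range.\<close>
  let ?\<rho> = "\<lambda>(\<tau>, (i, j), d) m. if \<tau> m = i then j else \<tau> m"
  let ?c = "\<lambda>(\<tau>, (i, j), d). \<chi> m. f (\<tau> m) $ m + (if \<tau> m = i then d else 0)"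
  have "finite {\<tau> :: 'n \<Rightarrow> 'i. range \<tau> \<subseteq> I}"
    using finite_PiE[of "UNIV :: 'n set" "\<lambda>_. I"] assms(1) by (simp add: PiE_UNIV_domain Pi_def image_subset_iff)
  moreover have "finite {(i, j). i \<in> I \<and> j \<in> I \<and> i \<noteq> j}"
    by (rule finite_subset[of _ "I \<times> I"]) (use assms(1) in auto)
  ultimately show "finite ?P"
    using assms(2) by (intro finite_cartesian_product)
  show "card (range (?\<rho> p)) \<le> card I - 1" if pP: "p \<in> ?P" for p
  proof -
    obtain \<tau> i j d where p: "p = (\<tau>, (i, j), d)" "range \<tau> \<subseteq> I" "i \<in> I" "j \<in> I" "i \<noteq> j"
      using pP by auto
    then have "range (?\<rho> p) \<subseteq> I - {i}"
      by auto
    then have "card (range (?\<rho> p)) \<le> card (I - {i})"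
      using assms(1) by (intro card_mono) auto
    then show ?thesis
      using p by simp
  qed
  show "\<exists>p\<in>?P. \<exists>z. \<forall>m. y $ m = ?c p $ m + z (?\<rho> p m)" if y: "y \<in> U" for y
  proof -
    obtain z i j where z: "\<forall>m. \<exists>i\<in>I. y $ m = f i $ m + z i"
      and ij: "i \<in> I" "j \<in> I" "i \<noteq> j" "z i - z j \<in> D"
      using U[OF y] by blast
    obtain \<tau> where \<tau>: "\<And>m. \<tau> m \<in> I \<and> y $ m = f (\<tau> m) $ m + z (\<tau> m)"
      using z by metis
    show ?thesis
    proof (intro bexI exI allI)
      show "(\<tau>, (i, j), z i - z j) \<in> ?P"
        using \<tau> ij by auto
      show "y $ m = ?c (\<tau>, (i, j), z i - z j) $ m + z (?\<rho> (\<tau>, (i, j), z i - z j) m)" for m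
        using \<tau>[of m] by auto
    qed
  qed
qed

section \<open>Regular matrices\<close>

text \<open>On a small ball about \<open>v\<close> in the directions of \<open>K\<close>, the map
  \<open>f\<close> is inverted by reading off the coordinates in \<open>K\<close>. So
  \<open>U\<close> contains a copy of a ball of dimension \<open>card K\<close>.\<close>

lemma not_dim_le_coordinate_section:
  fixes W :: "(real ^ 'n) set" and f :: "real ^ 'n \<Rightarrow> real ^ 'n" and K :: "'n set"
  assumes "open W" "v \<in> W" "continuous_on W f" "f ` W \<subseteq> U"
    and fK: "\<And>x i. x \<in> W \<Longrightarrow> i \<in> K \<Longrightarrow> f x $ i = x $ i"
  shows "\<not> top_of_set U dim_le int (card K) - 1"
proof -
  define B :: "(real ^ 'n) set" where "B = (\<lambda>k. axis k 1) ` K"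
  define S where "S = span B"
  have "B \<subseteq> Basis"
    by (auto simp: B_def axis_in_Basis_iff)
  then have "independent B"
    by (rule independent_mono[OF independent_Basis])
  then have "dim S = card B"
    unfolding S_def by (rule dim_span_eq_card_independent)
  moreover have "card B = card K"
    unfolding B_def by (rule card_image) (auto simp: inj_on_def axis_eq_axis)
  ultimately have dimS: "dim S = card K"
    by simp
  have S0: "x $ i = 0" if "x \<in> S" "i \<notin> K" for x i
  proof -
    have "subspace {x :: real ^ 'n. x $ i = 0}"
      by (auto simp: subspace_def)
    moreover have "B \<subseteq> {x. x $ i = 0}"
      using \<open>i \<notin> K\<close> by (auto simp: B_def axis_def)
    ultimately show ?thesis
      using \<open>x \<in> S\<close> span_minimal unfolding S_def by blast
  qed
  obtain r where r: "r > 0" "cball v r \<subseteq> W"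
    using assms(1,2) by (meson open_contains_cball)
  then have vW: "v + x \<in> W" if "x \<in> S \<inter> cball 0 r" for x
    using that by (auto simp: subset_iff dist_norm)
  let ?p = "\<lambda>u. \<chi> i. if i \<in> K then u $ i - v $ i else 0"
  have "\<not> top_of_set U dim_le int (dim S) - 1"
  proof (rule not_dim_le_embedded_ball)
    show "subspace S"
      by (simp add: S_def)
    show "r > 0" by fact
    show "continuous_on (S \<inter> cball 0 r) (\<lambda>x. f (v + x))"
      by (rule continuous_on_compose2[OF assms(3)]) (use vW in \<open>auto intro!: continuous_intros\<close>)
    show "(\<lambda>x. f (v + x)) ` (S \<inter> cball 0 r) \<subseteq> U"
      using vW assms(4) by blast
    show "continuous_on U ?p"
    proof (rule continuous_on_vec_lambda)
      fix i
      show "continuous_on U (\<lambda>u. if i \<in> K then u $ i - v $ i else 0)"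
        by (cases "i \<in> K") (auto intro!: continuous_intros)
    qed
    show "?p (f (v + x)) = x" if "x \<in> S \<inter> cball 0 r" for x
      using vW[OF that] that S0 by (auto simp: vec_eq_iff fK)
  qed
  then show ?thesis
    by (simp add: dimS)
qed

text \<open>The tropical map with matrix \<open>E\<close> retracts the whole space onto
  \<open>X\<close>. The number \<open>k\<close> is the least size of an index set \<open>K\<close>
  that suffices to recover each point of \<open>X\<close>.\<close>

lemma pure_dim_generator_dim_of_retract:
  fixes E :: "real ^ 'n ^ 'n"
  assumes X: "trop_closed X" "X \<noteq> {}"
    and le: "\<And>y i j. y \<in> X \<Longrightarrow> E $ i $ j + y $ j \<le> y $ i"
    and ex: "\<And>y i. y \<in> X \<Longrightarrow> \<exists>j. y $ i = E $ i $ j + y $ j"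
    and col: "\<And>j. column j E \<in> X"
  obtains k where "has_pure_dim X k" "generator_dim X = enat k"
proof -
  \<comment> \<open>The columns of \<open>E\<close> lie in \<open>X\<close>, so \<open>le\<close>
    becomes a triangle inequality for \<open>E\<close>.\<close>
  have trans: "E $ i $ j + E $ j $ k \<le> E $ i $ k" for i j k
    using le[OF col[of k], of i j] by (simp add: column_def)
  define Q where "Q K \<longleftrightarrow> (\<forall>y\<in>X. \<forall>i. \<exists>j\<in>K. y $ i = E $ i $ j + y $ j)" for K
  have "Q UNIV"
    using ex by (auto simp: Q_def)
  then obtain K where "Q K" and K_min: "\<And>K'. Q K' \<Longrightarrow> card K \<le> card K'"
    using ex_has_least_nat[of Q UNIV card] by blast
  have gen: "\<exists>j\<in>K. y $ i = E $ i $ j + y $ j" if "y \<in> X" for y i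
    using \<open>Q K\<close> that by (auto simp: Q_def)
  have "K \<noteq> {}"
    using gen X(2) by blast
  text \<open>By minimality, no \<open>y $ j\<close> with \<open>j \<in> K\<close> is always attained at another index of \<open>K\<close>.\<close>
  have irredundant: "\<exists>y\<in>X. \<forall>i\<in>K - {j}. y $ j \<noteq> E $ j $ i + y $ i" if "j \<in> K" for j
  proof (rule ccontr)
    assume neg: "\<not> ?thesis"
    have "Q (K - {j})"
      unfolding Q_def
    proof (intro ballI allI)
      fix y m assume "y \<in> X"
      obtain l where l: "l \<in> K" "y $ m = E $ m $ l + y $ l"
        using gen \<open>y \<in> X\<close> by blast
      show "\<exists>i\<in>K - {j}. y $ m = E $ m $ i + y $ i"
      proof (cases "l = j")
        case True
        obtain i where i: "i \<in> K - {j}" "y $ j = E $ j $ i + y $ i"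
          using neg \<open>y \<in> X\<close> by blast
        have "y $ m = E $ m $ i + y $ i"
          using l(2) i(2) trans[of m j i] le[OF \<open>y \<in> X\<close>, of m i] unfolding True by linarith
        with i show ?thesis by blast
      next
        case False
        with l show ?thesis by blast
      qed
    qed
    then have "card K \<le> card (K - {j})"
      by (rule K_min)
    moreover have "card (K - {j}) < card K"
      using that by (meson card_Diff1_less finite)
    ultimately show False
      by simp
  qed
  have diag: "E $ j $ j = 0" if "j \<in> K" for j
  proof -
    obtain y where "y \<in> X" "\<forall>i\<in>K - {j}. y $ j \<noteq> E $ j $ i + y $ i"
      using irredundant \<open>j \<in> K\<close> by blast
    moreover from this obtain i where "i \<in> K" "y $ j = E $ j $ i + y $ i"
      using gen by blast
    ultimately have "y $ j = E $ j $ j + y $ j"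
      by blast
    then show ?thesis
      by simp
  qed
  have neg: "E $ i $ j + E $ j $ i < 0" if "i \<in> K" "j \<in> K" "i \<noteq> j" for i j
  proof (rule ccontr)
    assume "\<not> ?thesis"
    then have *: "E $ i $ j + E $ j $ i \<ge> 0"
      by simp
    obtain y where y: "y \<in> X" "\<forall>l\<in>K - {j}. y $ j \<noteq> E $ j $ l + y $ l"
      using irredundant \<open>j \<in> K\<close> by blast
    \<comment> \<open>A nonnegative 2-cycle squeezes the two inequalities between
      \<open>y $ i\<close> and \<open>y $ j\<close> into equalities.\<close>
    have "y $ j = E $ j $ i + y $ i"
      using * le[OF y(1), of j i] le[OF y(1), of i j] by linarith
    moreover have "i \<in> K - {j}"
      using that by simp
    ultimately show False
      using y(2) by blast
  qed
  have hull_X: "trop_closed hull ((\<lambda>j. column j E) ` K) = X"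
  proof
    show "trop_closed hull ((\<lambda>j. column j E) ` K) \<subseteq> X"
      by (rule hull_minimal) (use X col in auto)
    show "X \<subseteq> trop_closed hull ((\<lambda>j. column j E) ` K)"
    proof
      fix y assume "y \<in> X"
      then have "\<forall>m. (\<forall>i\<in>K. column i E $ m + y $ i \<le> y $ m) \<and> (\<exists>i\<in>K. y $ m = column i E $ m + y $ i)"
        using le gen by (simp add: column_def)
      then show "y \<in> trop_closed hull ((\<lambda>j. column j E) ` K)"
        unfolding mem_trop_hull_iff[OF finite \<open>K \<noteq> {}\<close>] by (intro exI[of _ "\<lambda>i. y $ i"])
    qed
  qed
  \<comment> \<open>The retraction onto \<open>X\<close> that reads only the coordinates in
    \<open>K\<close>.\<close>
  define \<Phi> where "\<Phi> x = (\<chi> m. MAX j\<in>K. E $ m $ j + x $ j)" for x :: "real ^ 'n"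
  have cont\<Phi>: "continuous_on S \<Phi>" for S
    unfolding \<Phi>_def using \<open>K \<noteq> {}\<close> by (intro continuous_on_vec_lambda continuous_on_MAX continuous_intros) auto
  have \<Phi>_fix: "\<Phi> y = y" if "y \<in> X" for y
  proof -
    have "y $ m = (MAX j\<in>K. E $ m $ j + y $ j)" for m
      unfolding eq_MAX_iff[OF finite \<open>K \<noteq> {}\<close>] using le[OF that] gen[OF that] by blast
    then have "\<Phi> y $ m = y $ m" for m
      unfolding \<Phi>_def vec_lambda_beta by (rule sym)
    then show ?thesis
      by (simp add: vec_eq_iff)
  qed
  have \<Phi>_X: "\<Phi> x \<in> X" for x
  proof -
    have "\<Phi> x = (\<chi> m. MAX j\<in>K. trop_scale (x $ j) (column j E) $ m)"
      by (simp add: \<Phi>_def trop_scale_def column_def add.commute)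
    also have "\<dots> \<in> X"
      using X col \<open>K \<noteq> {}\<close> by (intro trop_closed_MAX) (auto simp: trop_closed_def)
    finally show ?thesis .
  qed
  \<comment> \<open>On this open set \<open>\<Phi>\<close> keeps the coordinates in
    \<open>K\<close>: each maximum is won by the diagonal term.\<close>
  define P where "P = {x :: real ^ 'n. \<forall>i\<in>K. \<forall>j\<in>K. i \<noteq> j \<longrightarrow> E $ i $ j + x $ j < x $ i}"
  have "P = (\<Inter>i\<in>K. \<Inter>j\<in>K - {i}. {x. E $ i $ j + x $ j < x $ i})"
    by (auto simp: P_def)
  moreover have "open {x :: real ^ 'n. E $ i $ j + x $ j < x $ i}" for i j
    by (intro open_Collect_less continuous_intros)
  ultimately have "open P"
    by (metis (no_types, lifting) finite open_INT)
  have \<Phi>_P: "\<Phi> x $ i = x $ i" if "x \<in> P" "i \<in> K" for x i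
  proof -
    have "x $ i = (MAX j\<in>K. E $ i $ j + x $ j)"
    proof (subst eq_MAX_iff)
      have "E $ i $ j + x $ j \<le> x $ i" if "j \<in> K" for j
        using \<open>x \<in> P\<close> \<open>i \<in> K\<close> that diag[of i] by (cases "i = j") (auto simp: P_def less_imp_le)
      moreover have "x $ i = E $ i $ i + x $ i"
        using diag \<open>i \<in> K\<close> by simp
      ultimately show "(\<forall>j\<in>K. E $ i $ j + x $ j \<le> x $ i) \<and> (\<exists>j\<in>K. x $ i = E $ i $ j + x $ j)"
        using \<open>i \<in> K\<close> by blast
    qed (use \<open>K \<noteq> {}\<close> in auto)
    then show ?thesis
      unfolding \<Phi>_def vec_lambda_beta by (rule sym)
  qed
  text \<open>The average of the columns lies in the interior of the cone \<open>P\<close>, because all nontrivial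
    cycles of \<open>E\<close> on \<open>K\<close> have negative weight.\<close>
  define w :: "real ^ 'n" where "w = (\<chi> i. (\<Sum>c\<in>K. E $ i $ c) / card K)"
  have cardK: "card K > 0"
    using \<open>K \<noteq> {}\<close> by (simp add: card_gt_0_iff)
  have w: "E $ i $ j + w $ j < w $ i" if "i \<in> K" "j \<in> K" "i \<noteq> j" for i j
  proof -
    have "(\<Sum>c\<in>K. E $ i $ j + E $ j $ c) < (\<Sum>c\<in>K. E $ i $ c)"
    proof (rule sum_strict_mono_ex1)
      \<comment> \<open>Strict at \<open>c = i\<close>: the 2-cycle is negative, while
        \<open>E $ i $ i = 0\<close>.\<close>
      show "\<exists>c\<in>K. E $ i $ j + E $ j $ c < E $ i $ c"
        using neg diag that by (intro bexI[of _ i]) auto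
    qed (use trans in auto)
    then have "card K * E $ i $ j + (\<Sum>c\<in>K. E $ j $ c) < (\<Sum>c\<in>K. E $ i $ c)"
      by (simp add: sum.distrib)
    then have "(card K * E $ i $ j + (\<Sum>c\<in>K. E $ j $ c)) / card K < (\<Sum>c\<in>K. E $ i $ c) / card K"
      using cardK by (intro divide_strict_right_mono) auto
    then show ?thesis
      using cardK \<open>K \<noteq> {}\<close> by (simp add: w_def add_divide_distrib)
  qed
  have low: "\<not> top_of_set U dim_le int (card K) - 1" if U: "openin (top_of_set X) U" "U \<noteq> {}" for U
  proof -
    obtain V where V: "open V" "U = X \<inter> V"
      using U(1) by (auto simp: openin_open)
    obtain y where y: "y \<in> X" "y \<in> V"
      using U(2) V(2) by blast
    \<comment> \<open>A small step from \<open>y\<close> towards \<open>w\<close> keeps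
      \<open>\<Phi>\<close> in \<open>V\<close>, because \<open>\<Phi>\<close> fixes
      \<open>y\<close>. It also enters \<open>P\<close>, because weak inequalities at
      \<open>y\<close> and strict ones at \<open>w\<close> average to strict ones.\<close>
    define \<gamma> where "\<gamma> t = \<Phi> (y + t *\<^sub>R (w - y))" for t :: real
    have "continuous_on UNIV \<gamma>"
      unfolding \<gamma>_def by (rule continuous_on_compose2[OF cont\<Phi>[of UNIV]]) (auto intro!: continuous_intros)
    then have "open (\<gamma> -` V)"
      using V(1) open_vimage by blast
    moreover have "0 \<in> \<gamma> -` V"
      using y by (simp add: \<gamma>_def \<Phi>_fix)
    ultimately obtain e where e: "e > 0" "ball 0 e \<subseteq> \<gamma> -` V"
      by (meson openE)
    define t where "t = min (e / 2) 1"
    have t: "0 < t" "t \<le> 1" "t \<in> ball 0 e"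
      using e by (auto simp: t_def min_def)
    define v where "v = y + t *\<^sub>R (w - y)"
    have "v \<in> P"
      unfolding P_def
    proof (intro CollectI ballI impI)
      fix i j assume ij: "i \<in> K" "j \<in> K" "i \<noteq> j"
      have "(1 - t) * (E $ i $ j + y $ j) \<le> (1 - t) * y $ i"
        using t le[OF y(1)] by (intro mult_left_mono) auto
      moreover have "t * (E $ i $ j + w $ j) < t * w $ i"
        using t w[OF ij] by (intro mult_strict_left_mono) auto
      ultimately show "E $ i $ j + v $ j < v $ i"
        by (simp add: v_def algebra_simps)
    qed
    moreover have "\<Phi> v \<in> V"
      using t(3) e(2) by (auto simp: v_def \<gamma>_def)
    moreover have "open (\<Phi> -` V)"
      using V(1) cont\<Phi>[of UNIV] open_vimage by blast
    ultimately show ?thesis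
      using \<open>open P\<close> \<Phi>_P \<Phi>_X V(2) cont\<Phi>
      by (intro not_dim_le_coordinate_section[of "P \<inter> \<Phi> -` V" v \<Phi>]) auto
  qed
  have up: "top_of_set U dim_le int (card K)" if "U \<subseteq> X" for U
    using dim_le_trop_hull[of K U "\<lambda>j. column j E"] that by (simp add: hull_X)
  have "has_pure_dim X (card K)"
    unfolding has_pure_dim_def has_top_dim_def using low up openin_imp_subset by blast
  moreover have "generator_dim X = enat (card K)"
  proof (rule antisym)
    have "generator_dim X \<le> enat (card ((\<lambda>j. column j E) ` K))"
      by (rule generator_dim_le) (simp_all add: hull_X)
    also have "\<dots> \<le> enat (card K)"
      by (simp add: card_image_le)
    finally show *: "generator_dim X \<le> enat (card K)" .
    then obtain g where g: "generator_dim X = enat g"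
      by (metis enat_ile)
    \<comment> \<open>A generating set of \<open>g\<close> elements bounds the dimension of
      \<open>X\<close> by \<open>g\<close>, which \<open>low\<close> forces to be at least
      \<open>card K\<close>.\<close>
    then obtain G where G: "finite G" "card G = g" "trop_closed hull G = X"
      by (rule generator_dim_attained)
    then have "top_of_set X dim_le int g"
      using dim_le_trop_hull[of G X "\<lambda>v. v"] by simp
    moreover have "\<not> top_of_set X dim_le int (card K) - 1"
      using low[of X] X(2) by simp
    ultimately have "\<not> int g \<le> int (card K) - 1"
      using dimension_le_mono by blast
    then show "enat (card K) \<le> generator_dim X"
      by (simp add: g)
  qed
  ultimately show ?thesis
    by (rule that)
qed

text \<open>With \<open>E = A B\<close>, the equation \<open>E A = A\<close> makes \<open>E\<close>
  fix every combination of columns of \<open>A\<close>, and the columns of \<open>B\<close> exhibit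
  those of \<open>E\<close> as such combinations.\<close>

lemma column_space_of_regular:
  fixes A :: "real ^ 'n ^ 'n"
  assumes "von_neumann_regular A"
  obtains k where "has_pure_dim (column_space A) k" "generator_dim (column_space A) = enat k"
proof -
  obtain B where "trop_mult (trop_mult A B) A = A"
    using assms by (auto simp: von_neumann_regular_def)
  define E where "E = trop_mult A B"
  have E: "E $ i $ j + A $ j $ k \<le> A $ i $ k" "\<exists>j. A $ i $ k = E $ i $ j + A $ j $ k" for i j k
    using trop_mult_component(1)[of E i j A k] trop_mult_component(2)[of E A i k]
      \<open>trop_mult (trop_mult A B) A = A\<close> by (simp_all add: E_def)
  show ?thesis
  proof (rule pure_dim_generator_dim_of_retract[of "column_space A" E])
    show "trop_closed (column_space A)"
      unfolding column_space_def by (rule trop_closed_trop_hull)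
    show "column_space A \<noteq> {}"
      using column_in_column_space by blast
    show "column j E \<in> column_space A" for j
      unfolding mem_column_space_iff column_def E_def
      using trop_mult_component(1)[of A _ _ B] trop_mult_component(2)[of A B]
      by (intro exI[of _ "\<lambda>k. B $ k $ j"]) auto
  next
    fix y i j assume "y \<in> column_space A"
    then obtain x where x: "\<And>i j. A $ i $ j + x j \<le> y $ i" "\<And>i. \<exists>j. y $ i = A $ i $ j + x j"
      unfolding mem_column_space_iff by blast
    have le: "E $ i $ j + y $ j \<le> y $ i" for j
    proof -
      obtain k where "y $ j = A $ j $ k + x k"
        using x(2) by blast
      then show ?thesis
        using E(1)[of i j k] x(1)[of i k] by linarith
    qed
    then show "E $ i $ j + y $ j \<le> y $ i" .
    obtain k where k: "y $ i = A $ i $ k + x k"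
      using x(2) by blast
    obtain j where j: "A $ i $ k = E $ i $ j + A $ j $ k"
      using E(2) by blast
    have "y $ i = E $ i $ j + y $ j"
      using k j x(1)[of j k] le[of j] by linarith
    then show "\<exists>j. y $ i = E $ i $ j + y $ j" ..
  qed (rule that)
qed

section \<open>Row generators as coordinates on the column space\<close>

text \<open>Expressing the rows of \<open>A\<close> through \<open>H\<close> gives \<open>N\<close>,
  and expressing \<open>H\<close> through the rows gives \<open>v\<close>. Substituting one into the
  other yields \<open>A = N v A\<close>, so \<open>N v\<close> fixes the column space.\<close>

lemma row_generators_factor:
  fixes A :: "real ^ 'n ^ 'm"
  assumes H: "finite H" "H \<noteq> {}" "trop_closed hull H = row_space A"
  obtains N v where
    "\<And>h. h \<in> H \<Longrightarrow> \<forall>m. (\<forall>i. A $ i $ m + v h i \<le> h $ m) \<and> (\<exists>i. h $ m = A $ i $ m + v h i)"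
    "\<And>y i h. y \<in> column_space A \<Longrightarrow> h \<in> H \<Longrightarrow> N i h + (MAX l. v h l + y $ l) \<le> y $ i"
    "\<And>y i. y \<in> column_space A \<Longrightarrow> \<exists>h\<in>H. y $ i = N i h + (MAX l. v h l + y $ l)"
proof -
  have "\<exists>x. \<forall>m. (\<forall>h\<in>H. h $ m + x h \<le> A $ i $ m) \<and> (\<exists>h\<in>H. A $ i $ m = h $ m + x h)" for i
  proof -
    have "row i A \<in> row_space A"
      unfolding row_space_def by (rule hull_inc) (auto simp: rows_def)
    then have "row i A \<in> trop_closed hull ((\<lambda>h. h) ` H)"
      by (simp add: H(3))
    then show ?thesis
      unfolding mem_trop_hull_iff[OF H(1,2)] by (simp add: row_def)
  qed
  then obtain N where N: "\<And>i m h. h \<in> H \<Longrightarrow> h $ m + N i h \<le> A $ i $ m"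
      "\<And>i m. \<exists>h\<in>H. A $ i $ m = h $ m + N i h"
    by metis
  have "\<exists>x. \<forall>m. (\<forall>i. A $ i $ m + x i \<le> h $ m) \<and> (\<exists>i. h $ m = A $ i $ m + x i)" if "h \<in> H" for h
  proof -
    have "h \<in> row_space A"
      using hull_inc[of h H trop_closed] that H(3) by simp
    then have "h \<in> trop_closed hull ((\<lambda>i. row i A) ` UNIV)"
      by (simp add: row_space_def rows_def full_SetCompr_eq)
    then show ?thesis
      by (subst (asm) mem_trop_hull_iff) (simp_all add: row_def)
  qed
  then obtain v where v: "\<And>h m i. h \<in> H \<Longrightarrow> A $ i $ m + v h i \<le> h $ m"
      "\<And>h m. h \<in> H \<Longrightarrow> \<exists>i. h $ m = A $ i $ m + v h i"
    by metis
  define z where "z h y = (MAX l. v h l + y $ l)" for h and y :: "real ^ 'm"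
  have z: "v h l + y $ l \<le> z h y" "\<exists>l. z h y = v h l + y $ l" for h l y
    using eq_MAX_iff[of UNIV "z h y" "\<lambda>l. v h l + y $ l"] by (auto simp: z_def)
  have le: "N i h + z h y \<le> y $ i" if y: "y \<in> column_space A" and "h \<in> H" for y i h
  proof -
    obtain x where x: "\<And>i j. A $ i $ j + x j \<le> y $ i" "\<And>i. \<exists>j. y $ i = A $ i $ j + x j"
      using y unfolding mem_column_space_iff by blast
    obtain l where l: "z h y = v h l + y $ l"
      using z(2) by blast
    obtain m where m: "y $ l = A $ l $ m + x m"
      using x(2) by blast
    show ?thesis
      using l m v(1)[OF \<open>h \<in> H\<close>, of l m] N(1)[OF \<open>h \<in> H\<close>, of m i] x(1)[of i m] by linarith
  qed
  have ex: "\<exists>h\<in>H. y $ i = N i h + z h y" if y: "y \<in> column_space A" for y i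
  proof -
    obtain x where x: "\<And>i j. A $ i $ j + x j \<le> y $ i" "\<And>i. \<exists>j. y $ i = A $ i $ j + x j"
      using y unfolding mem_column_space_iff by blast
    obtain m where m: "y $ i = A $ i $ m + x m"
      using x(2) by blast
    obtain h where h: "h \<in> H" "A $ i $ m = h $ m + N i h"
      using N(2) by blast
    obtain l where l: "h $ m = A $ l $ m + v h l"
      using v(2)[OF h(1)] by blast
    have "y $ i = N i h + z h y"
      using m h(2) l x(1)[of l m] z(1)[of h l y] le[OF y h(1), of i] by linarith
    with h(1) show ?thesis by blast
  qed
  show ?thesis
    by (rule that[of v N]) (use v le ex in \<open>simp_all add: z_def\<close>)
qed

text \<open>By the factorisation, the column space lies in the span of the columns of
  \<open>N\<close>, one for each element of \<open>H\<close>.\<close>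

lemma column_space_dim_le_row_generators:
  fixes A :: "real ^ 'n ^ 'm"
  assumes H: "finite H" "H \<noteq> {}" "trop_closed hull H = row_space A"
  shows "top_of_set (column_space A) dim_le int (card H)"
proof -
  obtain N v where N: "\<And>y i h. y \<in> column_space A \<Longrightarrow> h \<in> H \<Longrightarrow> N i h + (MAX l. v h l + y $ l) \<le> y $ i"
    "\<And>y i. y \<in> column_space A \<Longrightarrow> \<exists>h\<in>H. y $ i = N i h + (MAX l. v h l + y $ l)"
    by (rule row_generators_factor[OF H]) (rule that)
  have "column_space A \<subseteq> trop_closed hull ((\<lambda>h. \<chi> i. N i h) ` H)"
  proof
    fix y assume y: "y \<in> column_space A"
    show "y \<in> trop_closed hull ((\<lambda>h. \<chi> i. N i h) ` H)"
      unfolding mem_trop_hull_iff[OF H(1,2)]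
      using N(1)[OF y] N(2)[OF y] by (intro exI[of _ "\<lambda>h. MAX l. v h l + y $ l"]) simp
  qed
  then show ?thesis
    by (rule dim_le_trop_hull[OF H(1)])
qed

text \<open>Applied to a regular matrix and to its transpose, this makes the invariants of the two
  spaces agree.\<close>

lemma pure_dim_le_generator_dim_row_space:
  assumes "has_pure_dim (column_space A) k" "generator_dim (row_space A) = enat l"
  shows "k \<le> l"
proof -
  obtain H where H: "finite H" "card H = l" "trop_closed hull H = row_space A"
    by (rule generator_dim_attained[OF assms(2)])
  have "row_space A \<noteq> {}"
    by (metis column_in_column_space empty_iff row_space_transpose transpose_transpose)
  with H have "H \<noteq> {}"
    by auto
  then have "top_of_set (column_space A) dim_le int l"
    using column_space_dim_le_row_generators[OF H(1) _ H(3)] H(2) by simp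
  moreover have "\<not> top_of_set (column_space A) dim_le int k - 1"
  proof -
    have "column_space A \<noteq> {}"
      using column_in_column_space by blast
    then have "has_top_dim (top_of_set (column_space A)) (int k)"
      using assms(1) openin_subtopology_self[of "column_space A"]
      unfolding has_pure_dim_def by blast
    then show ?thesis
      by (simp add: has_top_dim_def)
  qed
  ultimately have "\<not> int l \<le> int k - 1"
    using dimension_le_mono by blast
  then show ?thesis by simp
qed

section \<open>From pure dimension to regularity\<close>

text \<open>Purity makes the generic points dense; the equal sizes of \<open>G\<close> and
  \<open>H\<close> turn the attaining generators at such a point into a bijection.\<close>

lemma regular_of_pure_dim:
  fixes A :: "real ^ 'n ^ 'n"
  assumes pure: "has_pure_dim (column_space A) k"
    and "generator_dim (row_space A) = enat k" "generator_dim (column_space A) = enat k"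
  shows "von_neumann_regular A"
proof -
  let ?C = "column_space A"
  have C_ne: "?C \<noteq> {}"
    using column_in_column_space by blast
  have "row_space A \<noteq> {}"
    by (metis column_in_column_space empty_iff row_space_transpose transpose_transpose)
  obtain H where H: "finite H" "card H = k" "trop_closed hull H = row_space A"
    by (rule generator_dim_attained[OF assms(2)])
  then have "H \<noteq> {}"
    using \<open>row_space A \<noteq> {}\<close> by auto
  obtain G where G: "finite G" "card G = k" "trop_closed hull G = ?C"
    by (rule generator_dim_attained[OF assms(3)])
  then have "G \<noteq> {}"
    using C_ne by auto
  have "G \<subseteq> ?C"
    using hull_subset[of G trop_closed] G(3) by simp
  obtain N v where v: "\<And>h. h \<in> H \<Longrightarrow> \<forall>m. (\<forall>i. A $ i $ m + v h i \<le> h $ m) \<and> (\<exists>i. h $ m = A $ i $ m + v h i)"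
    and N: "\<And>y i h. y \<in> ?C \<Longrightarrow> h \<in> H \<Longrightarrow> N i h + (MAX l. v h l + y $ l) \<le> y $ i"
      "\<And>y i. y \<in> ?C \<Longrightarrow> \<exists>h\<in>H. y $ i = N i h + (MAX l. v h l + y $ l)"
    by (rule row_generators_factor[OF H(1) \<open>H \<noteq> {}\<close> H(3)]) (rule that)
  define z where "z h y = (MAX l. v h l + y $ l)" for h and y :: "real ^ 'n"
  have z: "v h l + y $ l \<le> z h y" "\<exists>l. z h y = v h l + y $ l" for h l y
    using eq_MAX_iff[of UNIV "z h y" "\<lambda>l. v h l + y $ l"] by (auto simp: z_def)
  have cont_z: "continuous_on S (z h)" for S h
    unfolding z_def by (intro continuous_on_MAX continuous_intros) auto
  \<comment> \<open>Each \<open>z h\<close> commutes with maxima and scaling, so the coefficients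
    \<open>x\<close> expressing \<open>y\<close> through \<open>G\<close> also express
    \<open>z h y\<close> through the values \<open>z h g\<close>.\<close>
  have coords: "\<exists>x. (\<forall>g\<in>G. (\<forall>m. g $ m + x g \<le> y $ m) \<and> (\<forall>h. z h g + x g \<le> z h y)) \<and>
      (\<forall>m. \<exists>g\<in>G. y $ m = g $ m + x g) \<and> (\<forall>h. \<exists>g\<in>G. z h y = z h g + x g)" if "y \<in> ?C" for y
  proof -
    have "y \<in> trop_closed hull ((\<lambda>g. g) ` G)"
      using that by (simp add: G(3))
    then obtain x where x: "\<And>m g. g \<in> G \<Longrightarrow> g $ m + x g \<le> y $ m" "\<And>m. \<exists>g\<in>G. y $ m = g $ m + x g"
      unfolding mem_trop_hull_iff[OF G(1) \<open>G \<noteq> {}\<close>] by blast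
    have le: "z h g + x g \<le> z h y" if "g \<in> G" for h g
    proof -
      obtain l where "z h g = v h l + g $ l"
        using z(2) by blast
      then show ?thesis
        using x(1)[OF that, of l] z(1)[of h l y] by linarith
    qed
    moreover have "\<exists>g\<in>G. z h y = z h g + x g" for h
    proof -
      obtain l where l: "z h y = v h l + y $ l"
        using z(2) by blast
      obtain g where g: "g \<in> G" "y $ l = g $ l + x g"
        using x(2) by blast
      have "z h y = z h g + x g"
        using l g(2) z(1)[of h l g] le[OF g(1), of h] by linarith
      with g(1) show ?thesis by blast
    qed
    ultimately show ?thesis
      using x by blast
  qed
  \<comment> \<open>If one \<open>g\<close> attained both \<open>z h y\<close> and
    \<open>z h' y\<close>, the two would differ by \<open>z h g - z h' g\<close>. Excluding these
    differences rules this out without mentioning coefficients.\<close>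
  define good where "good y \<longleftrightarrow>
      (\<forall>h\<in>H. \<forall>h'\<in>H. \<forall>g\<in>G. h \<noteq> h' \<longrightarrow> z h y - z h' y \<noteq> z h g - z h' g)" for y
  have dense: "\<exists>y\<in>U. good y" if U: "openin (top_of_set ?C) U" "U \<noteq> {}" for U
  proof (rule ccontr)
    assume "\<not> ?thesis"
    then have bad: "\<not> good y" if "y \<in> U" for y
      using that by blast
    have "U \<subseteq> ?C"
      using U openin_imp_subset by blast
    \<comment> \<open>Bad points satisfy one of finitely many equations
      \<open>z h y - z h' y = d\<close>, and \<open>N\<close> recovers them from their
      \<open>z\<close>-coordinates. An open set of them would have dimension below \<open>k\<close>,
      against purity.\<close>
    define D where "D = (\<lambda>(h, h', g). z h g - z h' g) ` (H \<times> H \<times> G)"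
    have "top_of_set U dim_le int (card H - 1)"
    proof (rule dim_le_trop_hull_hyperplanes)
      show "finite D"
        using H G by (simp add: D_def)
      fix y assume "y \<in> U"
      then have "y \<in> ?C"
        using \<open>U \<subseteq> ?C\<close> by blast
      obtain h h' g where hg: "h \<in> H" "h' \<in> H" "g \<in> G" "h \<noteq> h'" "z h y - z h' y = z h g - z h' g"
        using bad[OF \<open>y \<in> U\<close>] unfolding good_def by blast
      then have "z h y - z h' y \<in> D"
        unfolding D_def by (intro image_eqI[of _ _ "(h, h', g)"]) auto
      moreover have "\<exists>h\<in>H. y $ m = (\<chi> i. N i h) $ m + z h y" for m
        using N(2)[OF \<open>y \<in> ?C\<close>] by (simp add: z_def)
      ultimately show "\<exists>x. (\<forall>m. \<exists>h\<in>H. y $ m = (\<chi> i. N i h) $ m + x h) \<and>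
          (\<exists>h\<in>H. \<exists>h'\<in>H. h \<noteq> h' \<and> x h - x h' \<in> D)"
        using hg(1,2,4) by (intro exI[of _ "\<lambda>h. z h y"]) blast
    qed (rule H)
    \<comment> \<open>The natural subtraction is exact because \<open>H\<close> is nonempty.\<close>
    moreover have "int (card H - 1) = int k - 1"
    proof -
      have "card H > 0"
        using H(1) \<open>H \<noteq> {}\<close> by (simp add: card_gt_0_iff)
      then show ?thesis
        using H(2) by (simp add: of_nat_diff Suc_le_eq)
    qed
    moreover have "\<not> top_of_set U dim_le int k - 1"
      using pure U unfolding has_pure_dim_def has_top_dim_def by blast
    ultimately show False
      by simp
  qed
  \<comment> \<open>\<open>\<sigma> h\<close> is the only generator attaining \<open>z h y\<close>;
    the first two conditions on \<open>x\<close> unfold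
    \<open>y = max_h (\<sigma> h + x (\<sigma> h))\<close>.\<close>
  define assigns where "assigns \<sigma> y \<longleftrightarrow> bij_betw \<sigma> H G \<and> (\<exists>x.
      (\<forall>m. \<exists>h\<in>H. y $ m = \<sigma> h $ m + x (\<sigma> h)) \<and> (\<forall>h\<in>H. \<forall>m. \<sigma> h $ m + x (\<sigma> h) \<le> y $ m) \<and>
      (\<forall>h\<in>H. z h y = z h (\<sigma> h) + x (\<sigma> h) \<and> (\<forall>g\<in>G. g \<noteq> \<sigma> h \<longrightarrow> z h g + x g < z h y)))" for \<sigma> y
  have ex_assigns: "\<exists>\<sigma>. assigns \<sigma> y" if y: "y \<in> ?C" "good y" for y
  proof -
    obtain x where x: "\<And>g m. g \<in> G \<Longrightarrow> g $ m + x g \<le> y $ m" "\<And>g h. g \<in> G \<Longrightarrow> z h g + x g \<le> z h y"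
        "\<And>m. \<exists>g\<in>G. y $ m = g $ m + x g" "\<And>h. \<exists>g\<in>G. z h y = z h g + x g"
      using coords[OF y(1)] by blast
    obtain \<sigma> where \<sigma>: "\<And>h. \<sigma> h \<in> G" "\<And>h. z h y = z h (\<sigma> h) + x (\<sigma> h)"
      using x(4) by metis
    have unique: "h = h'" if "h \<in> H" "h' \<in> H" "z h' y = z h' (\<sigma> h) + x (\<sigma> h)" for h h'
    proof (rule ccontr)
      assume "h \<noteq> h'"
      moreover have "z h y - z h' y = z h (\<sigma> h) - z h' (\<sigma> h)"
        using \<sigma>(2)[of h] that(3) by linarith
      ultimately show False
        using y(2) that \<sigma>(1) unfolding good_def by blast
    qed
    \<comment> \<open>Injectivity between sets of equal size gives a bijection. Every other
      \<open>g\<close> is then assigned to some other \<open>h'\<close>, so by goodness it cannot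
      attain \<open>z h y\<close> as well.\<close>
    have "inj_on \<sigma> H"
      by (rule inj_onI) (metis unique \<sigma>(2))
    moreover have "\<sigma> ` H = G"
      using \<sigma>(1) G H card_image[OF \<open>inj_on \<sigma> H\<close>] by (intro card_subset_eq) auto
    ultimately have bij: "bij_betw \<sigma> H G"
      by (simp add: bij_betw_def)
    have "z h g + x g < z h y" if "h \<in> H" "g \<in> G" "g \<noteq> \<sigma> h" for h g
    proof -
      obtain h' where "h' \<in> H" "g = \<sigma> h'"
        using \<open>\<sigma> ` H = G\<close> \<open>g \<in> G\<close> by blast
      then have "z h y \<noteq> z h g + x g"
        using unique[of h' h] that by metis
      then show ?thesis
        using x(2)[OF \<open>g \<in> G\<close>, of h] by linarith
    qed
    moreover have "\<exists>h\<in>H. y $ m = \<sigma> h $ m + x (\<sigma> h)" for m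
    proof -
      obtain g where "g \<in> \<sigma> ` H" "y $ m = g $ m + x g"
        using x(3) \<open>\<sigma> ` H = G\<close> by metis
      then show ?thesis
        by blast
    qed
    ultimately have "assigns \<sigma> y"
      unfolding assigns_def using bij x(1) \<sigma> by (intro conjI exI[of _ x]) simp_all
    then show ?thesis
      by blast
  qed
  text \<open>An assignment is the strict optimum of the assignment problem with weights \<open>z h g\<close>, so it
    does not depend on the point.\<close>
  have optimal: "(\<Sum>h\<in>H. z h (\<tau> h)) < (\<Sum>h\<in>H. z h (\<sigma> h))"
    if \<sigma>: "assigns \<sigma> y" and \<tau>: "bij_betw \<tau> H G" and ne: "\<exists>h\<in>H. \<tau> h \<noteq> \<sigma> h" for \<sigma> \<tau> y
  proof -
    obtain x where bij: "bij_betw \<sigma> H G" and x: "\<And>h. h \<in> H \<Longrightarrow> z h y = z h (\<sigma> h) + x (\<sigma> h)"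
        "\<And>h g. h \<in> H \<Longrightarrow> g \<in> G \<Longrightarrow> g \<noteq> \<sigma> h \<Longrightarrow> z h g + x g < z h y"
      using \<sigma> unfolding assigns_def by blast
    have \<tau>G: "\<tau> h \<in> G" if "h \<in> H" for h
      using \<tau> that bij_betwE by blast
    have "(\<Sum>h\<in>H. z h (\<tau> h) + x (\<tau> h)) < (\<Sum>h\<in>H. z h (\<sigma> h) + x (\<sigma> h))"
    proof (rule sum_strict_mono_ex1)
      show "\<forall>h\<in>H. z h (\<tau> h) + x (\<tau> h) \<le> z h (\<sigma> h) + x (\<sigma> h)"
      proof
        fix h assume "h \<in> H"
        then show "z h (\<tau> h) + x (\<tau> h) \<le> z h (\<sigma> h) + x (\<sigma> h)"
          using x(2)[of h "\<tau> h"] x(1)[of h] \<tau>G[of h] by (cases "\<tau> h = \<sigma> h") auto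
      qed
      show "\<exists>h\<in>H. z h (\<tau> h) + x (\<tau> h) < z h (\<sigma> h) + x (\<sigma> h)"
        using ne x \<tau>G by metis
    qed (rule H)
    \<comment> \<open>Both bijections sum \<open>x\<close> over all of \<open>G\<close>, so the
      coefficients cancel and the inequality no longer involves \<open>y\<close>.\<close>
    moreover have "(\<Sum>h\<in>H. x (\<tau> h)) = sum x G" "(\<Sum>h\<in>H. x (\<sigma> h)) = sum x G"
      using \<tau> bij by (auto intro: sum.reindex_bij_betw)
    ultimately show ?thesis
      by (simp add: sum.distrib)
  qed
  obtain y0 where y0: "y0 \<in> ?C" "good y0"
    using dense[of ?C] C_ne by auto
  obtain \<sigma> where \<sigma>: "assigns \<sigma> y0"
    using ex_assigns[OF y0] by blast
  have \<sigma>G: "\<sigma> h \<in> ?C" if "h \<in> H" for h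
    using \<sigma> that \<open>G \<subseteq> ?C\<close> bij_betwE unfolding assigns_def by blast
  \<comment> \<open>Here \<open>x (\<sigma> h)\<close> is replaced by
    \<open>z h y - z h (\<sigma> h)\<close>. The equation is then continuous in \<open>y\<close> and
    passes from the dense good points to the whole column space.\<close>
  define Z where "Z = {y. \<forall>m. y $ m = (MAX h\<in>H. \<sigma> h $ m + (z h y - z h (\<sigma> h)))}"
  have good_Z: "y \<in> Z" if y: "y \<in> ?C" "good y" for y
  proof -
    obtain \<tau> where \<tau>: "assigns \<tau> y"
      using ex_assigns[OF y] by blast
    have bij: "bij_betw \<sigma> H G" "bij_betw \<tau> H G"
      using \<sigma> \<tau> by (auto simp: assigns_def)
    \<comment> \<open>If the assignments differed, each would be strictly better than the
      other.\<close>
    have eq: "\<tau> h = \<sigma> h" if "h \<in> H" for h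
      using optimal[OF \<sigma> bij(2)] optimal[OF \<tau> bij(1)] that by (metis less_asym)
    obtain x where x: "\<And>m. \<exists>h\<in>H. y $ m = \<tau> h $ m + x (\<tau> h)"
        "\<And>h m. h \<in> H \<Longrightarrow> \<tau> h $ m + x (\<tau> h) \<le> y $ m" "\<And>h. h \<in> H \<Longrightarrow> z h y = z h (\<tau> h) + x (\<tau> h)"
      using \<tau> unfolding assigns_def by blast
    have x\<sigma>: "x (\<tau> h) = z h y - z h (\<sigma> h)" if "h \<in> H" for h
      using x(3)[OF that] eq[OF that] by simp
    have "y $ m = (MAX h\<in>H. \<sigma> h $ m + (z h y - z h (\<sigma> h)))" for m
      unfolding eq_MAX_iff[OF H(1) \<open>H \<noteq> {}\<close>]
    proof
      show "\<forall>h\<in>H. \<sigma> h $ m + (z h y - z h (\<sigma> h)) \<le> y $ m"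
        using x(2)[of _ m] by (metis eq x\<sigma>)
      show "\<exists>h\<in>H. y $ m = \<sigma> h $ m + (z h y - z h (\<sigma> h))"
        using x(1)[of m] by (metis eq x\<sigma>)
    qed
    then show ?thesis
      unfolding Z_def by blast
  qed
  have "closed Z"
    unfolding Z_def using H(1) \<open>H \<noteq> {}\<close> cont_z
    by (intro closed_Collect_all closed_Collect_eq continuous_on_MAX continuous_intros) auto
  have "?C \<subseteq> Z"
  proof (rule ccontr)
    assume "\<not> ?C \<subseteq> Z"
    then have "?C \<inter> - Z \<noteq> {}"
      by blast
    moreover have "openin (top_of_set ?C) (?C \<inter> - Z)"
      using \<open>closed Z\<close> by (intro openin_open_Int open_Compl)
    ultimately obtain y where "y \<in> ?C \<inter> - Z" "good y"
      using dense by blast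
    then show False
      using good_Z by blast
  qed
  then have "y $ m = (MAX h\<in>H. \<sigma> h $ m + (z h y - z h (\<sigma> h)))" if "y \<in> ?C" for y m
    using that unfolding Z_def by blast
  then have Z: "\<And>h. h \<in> H \<Longrightarrow> \<sigma> h $ m + (z h y - z h (\<sigma> h)) \<le> y $ m"
      "\<exists>h\<in>H. y $ m = \<sigma> h $ m + (z h y - z h (\<sigma> h))" if "y \<in> ?C" for y m
    using that unfolding eq_MAX_iff[OF H(1) \<open>H \<noteq> {}\<close>] by blast+
  have "\<exists>x. \<forall>i. (\<forall>p. A $ i $ p + x p \<le> \<sigma> h $ i) \<and> (\<exists>p. \<sigma> h $ i = A $ i $ p + x p)" if "h \<in> H" for h
    using \<sigma>G[OF that] unfolding mem_column_space_iff .
  then obtain w where w: "\<And>h i p. h \<in> H \<Longrightarrow> A $ i $ p + w h p \<le> \<sigma> h $ i"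
      "\<And>h i. h \<in> H \<Longrightarrow> \<exists>p. \<sigma> h $ i = A $ i $ p + w h p"
    by metis
  \<comment> \<open>Inserting \<open>\<sigma> h = max_p (A_p + w h p)\<close>, with
    \<open>A_p\<close> the columns of \<open>A\<close>, and the definition of \<open>z h y\<close>
    into the equation of \<open>Z\<close> yields \<open>y = A B y\<close>.\<close>
  define B :: "real ^ 'n ^ 'n" where "B = (\<chi> p l. MAX h\<in>H. w h p - z h (\<sigma> h) + v h l)"
  have B: "\<And>h. h \<in> H \<Longrightarrow> w h p - z h (\<sigma> h) + v h l \<le> B $ p $ l"
      "\<exists>h\<in>H. B $ p $ l = w h p - z h (\<sigma> h) + v h l" for p l
    using eq_MAX_iff[OF H(1) \<open>H \<noteq> {}\<close>, of "B $ p $ l" "\<lambda>h. w h p - z h (\<sigma> h) + v h l"]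
    by (auto simp: B_def)
  have "trop_mult (trop_mult A B) A = A"
    unfolding trop_mult_mult_eq_iff
  proof (intro allI conjI)
    fix i j
    have y: "column j A \<in> ?C"
      by (rule column_in_column_space)
    have le: "A $ i $ p + B $ p $ l + A $ l $ j \<le> A $ i $ j" for p l
    proof -
      obtain h where h: "h \<in> H" "B $ p $ l = w h p - z h (\<sigma> h) + v h l"
        using B(2) by blast
      show ?thesis
        using h(2) w(1)[OF h(1), of i p] Z(1)[OF y h(1), of i] z(1)[of h l "column j A"]
        by (simp add: column_def)
    qed
    then show "A $ i $ p + B $ p $ l + A $ l $ j \<le> A $ i $ j" for p l .
    obtain h where h: "h \<in> H" "column j A $ i = \<sigma> h $ i + (z h (column j A) - z h (\<sigma> h))"
      using Z(2)[OF y] by blast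
    obtain p where p: "\<sigma> h $ i = A $ i $ p + w h p"
      using w(2)[OF h(1)] by blast
    obtain l where l: "z h (column j A) = v h l + column j A $ l"
      using z(2) by blast
    have "A $ i $ j = A $ i $ p + B $ p $ l + A $ l $ j"
      using h(2) p l B(1)[OF h(1), of p l] le[of p l] by (simp add: column_def)
    then show "\<exists>p l. A $ i $ j = A $ i $ p + B $ p $ l + A $ l $ j"
      by blast
  qed
  then show ?thesis
    unfolding von_neumann_regular_def ..
qed

theorem corollary1p2:
  fixes A :: "real ^ 'n ^ 'n"
  shows "von_neumann_regular A \<longleftrightarrow>
    (\<exists>k :: nat. has_pure_dim (row_space A) k \<and> generator_dim (row_space A) = enat k \<and>
                has_pure_dim (column_space A) k \<and> generator_dim (column_space A) = enat k)"
proof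
  assume reg: "von_neumann_regular A"
  obtain k where k: "has_pure_dim (column_space A) k" "generator_dim (column_space A) = enat k"
    by (rule column_space_of_regular[OF reg])
  obtain l where "has_pure_dim (column_space (transpose A)) l"
      "generator_dim (column_space (transpose A)) = enat l"
    by (rule column_space_of_regular[OF von_neumann_regular_transpose[OF reg]])
  then have l: "has_pure_dim (row_space A) l" "generator_dim (row_space A) = enat l"
    by (simp_all flip: row_space_transpose)
  have "k \<le> l"
    by (rule pure_dim_le_generator_dim_row_space[OF k(1) l(2)])
  \<comment> \<open>Transposition exchanges row and column space, giving the reverse
    inequality.\<close>
  moreover have "l \<le> k"
    using pure_dim_le_generator_dim_row_space[of "transpose A" l k] k(2) l(1)
    by (simp add: row_space_transpose) (simp flip: row_space_transpose)
  ultimately show "\<exists>k. has_pure_dim (row_space A) k \<and> generator_dim (row_space A) = enat k \<and>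
                has_pure_dim (column_space A) k \<and> generator_dim (column_space A) = enat k"
    using k l by auto
next
  assume "\<exists>k. has_pure_dim (row_space A) k \<and> generator_dim (row_space A) = enat k \<and>
              has_pure_dim (column_space A) k \<and> generator_dim (column_space A) = enat k"
  then show "von_neumann_regular A"
    using regular_of_pure_dim by blast
qed

end
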